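(* The online strategy BottomLeft for strip packing of squares under the Tetris and gravity constraints is (asymptotically) $3.5$-competitive. More precisely, for every finite input sequence of squares with side lengths $a_1,\dots,a_n\in(0,1]$, the height $BL$ of the packing produced by BottomLeft satisfies $BL \le 3.5\cdot OPT + 2.5$, where $OPT$ is the height of an optimal packing of the same squares.
   Context: Problem (online square strip packing with Tetris and gravity constraints): Let $S$ be a semi-infinite vertical strip of width $1$ (bounded by a bottom side and left and right sides). A sequence of axis-parallel squares $A_1,\dots,A_n$ with side lengths $a_i\le 1$ arrives online, one at a time, unknown in advance; each square must be placed (irrevocably) before the next one is revealed. Initially a square is located above all previously placed squares. Squares may not overlap and their sides must be parallel to the sides of the strip. Tetris constraint: at the time a square is placed, there must be a collision-free path (through unoccupied space) from its initial position at the top of the strip to its final position. Gravity constraint: no square may ever move upward along its path, and in its final position a square must be supported from below, i.e., either its bottom side lies on the bottom of the strip or the intersection of its bottom side with the top side of some previously placed square is a line segment of positive length. The height of a packing is the distance between the bottom of $S$ and the highest point occupied by a square; the objective is to minimize the height. $OPT$ denotes the minimum possible height of a packing of the given squares. BottomLeft: each arriving square is moved along a collision-free path from the top of the strip, never moving in the positive $y$-direction, to a final position that is as close as possible to the bottom of the strip; among all such bottommost reachable positions, the leftmost one is chosen. An online algorithm is (asymptotically) $c$-competitive if there is a constant $b$ such that for every input sequence its height is at most $c\cdot OPT + b$. *)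

theory Defs
  imports "HOL-Analysis.Analysis"
begin

type_synonym point = "real \<times> real"

text \<open>A placed square is given by its lower left corner and its side length.\<close>

type_synonym placed = "point \<times> real"

definition square :: "placed \<Rightarrow> point set" where
  "square s = (case s of ((x, y), a) \<Rightarrow> {x..x + a} \<times> {y..y + a})"

definition bottom_side :: "placed \<Rightarrow> point set" where
  "bottom_side s = (case s of ((x, y), a) \<Rightarrow> {x..x + a} \<times> {y})"

definition top_side :: "placed \<Rightarrow> point set" where
  "top_side s = (case s of ((x, y), a) \<Rightarrow> {x..x + a} \<times> {y + a})"

definition strip :: "point set" where
  "strip = {0..1} \<times> {0..}"

definition strip_bottom :: "point set" where
  "strip_bottom = {0..1} \<times> {0}"

text \<open>Squares may touch, but their interiors must not meet. In particular a square
  may slide along other squares and pass through a gap of exactly its own width.\<close>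

definition non_overlapping :: "placed \<Rightarrow> placed \<Rightarrow> bool" where
  "non_overlapping s t \<longleftrightarrow> interior (square s) \<inter> interior (square t) = {}"

definition height :: "placed list \<Rightarrow> real" where
  "height P = Max (insert 0 ((\<lambda>((x, y), a). y + a) ` set P))"

definition valid_input :: "real list \<Rightarrow> bool" where
  "valid_input as \<longleftrightarrow> (\<forall>a\<in>set as. 0 < a \<and> a \<le> 1)"

text \<open>An optimal packing is an arbitrary packing of the given squares. It does not have to
  satisfy the Tetris and the gravity constraint.\<close>

definition packing :: "real list \<Rightarrow> placed list \<Rightarrow> bool" where
  "packing as P \<longleftrightarrow>
     map snd P = as \<and> (\<forall>s\<in>set P. square s \<subseteq> strip) \<and> sorted_wrt non_overlapping P"

definition OPT :: "real list \<Rightarrow> real" where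
  "OPT as = Inf {height P | P. packing as P}"

definition free :: "placed list \<Rightarrow> real \<Rightarrow> point \<Rightarrow> bool" where
  "free P a p \<longleftrightarrow> square (p, a) \<subseteq> strip \<and> (\<forall>t\<in>set P. non_overlapping (p, a) t)"

definition reachable :: "placed list \<Rightarrow> real \<Rightarrow> point set" where
  "reachable P a = {p. \<exists>g. path g \<and> height P \<le> snd (pathstart g) \<and> pathfinish g = p \<and>
     (\<forall>q\<in>path_image g. free P a q) \<and> antimono_on {0..1} (\<lambda>t. snd (g t))}"

definition supported :: "placed list \<Rightarrow> placed \<Rightarrow> bool" where
  "supported P s \<longleftrightarrow> bottom_side s \<subseteq> strip_bottom \<or>
     (\<exists>t\<in>set P. \<exists>u v. u \<noteq> v \<and> bottom_side s \<inter> top_side t = closed_segment u v)"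

text \<open>A strategy maps the squares placed so far and the side length of the arriving square
  to the final position of that square.\<close>

type_synonym strategy = "placed list \<Rightarrow> real \<Rightarrow> point"

definition run :: "strategy \<Rightarrow> real list \<Rightarrow> placed list" where
  "run A as = foldl (\<lambda>P a. P @ [(A P a, a)]) [] as"

definition online_strategy :: "strategy \<Rightarrow> bool" where
  "online_strategy A \<longleftrightarrow> (\<forall>as a. valid_input (as @ [a]) \<longrightarrow>
     A (run A as) a \<in> reachable (run A as) a \<and>
     supported (run A as) (A (run A as) a, a))"

definition competitive :: "strategy \<Rightarrow> real \<Rightarrow> bool" where
  "competitive A c \<longleftrightarrow> online_strategy A \<and>
     (\<exists>b. \<forall>as. valid_input as \<longrightarrow> height (run A as) \<le> c * OPT as + b)"

definition is_bottom_left :: "placed list \<Rightarrow> real \<Rightarrow> point \<Rightarrow> bool" where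
  "is_bottom_left P a p \<longleftrightarrow> p \<in> reachable P a \<and>
     (\<forall>q\<in>reachable P a. snd p \<le> snd q) \<and>
     (\<forall>q\<in>reachable P a. snd q = snd p \<longrightarrow> fst p \<le> fst q)"

definition bottom_left :: strategy where
  "bottom_left P a = (THE p. is_bottom_left P a p)"

lemma non_overlapping_iff:
  "non_overlapping ((x, y), a) ((x', y'), b) \<longleftrightarrow>
     a \<le> 0 \<or> b \<le> 0 \<or> x + a \<le> x' \<or> x' + b \<le> x \<or> y + a \<le> y' \<or> y' + b \<le> y"
proof -
  have *: "{u<..<u + c} \<inter> {u'<..<u' + d} = {} \<longleftrightarrow>
      c \<le> 0 \<or> d \<le> 0 \<or> u + c \<le> u' \<or> u' + d \<le> u" for u u' c d :: real
    by (simp only: Int_greaterThanLessThan greaterThanLessThan_empty_iff) linarith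
  show ?thesis
    unfolding non_overlapping_def square_def
    by (auto simp add: interior_Times Times_Int_Times * simp del: Int_greaterThanLessThan)
qed

lemma square_subset_strip_iff:
  "0 < a \<Longrightarrow> square ((x, y), a) \<subseteq> strip \<longleftrightarrow> 0 \<le> x \<and> x + a \<le> 1 \<and> 0 \<le> y"
  by (simp add: square_def strip_def times_subset_iff)

lemma free_iff:
  assumes "0 < a"
  shows "free P a (x, y) \<longleftrightarrow> 0 \<le> x \<and> x + a \<le> 1 \<and> 0 \<le> y \<and>
    (\<forall>((x', y'), b)\<in>set P.
       b \<le> 0 \<or> x + a \<le> x' \<or> x' + b \<le> x \<or> y + a \<le> y' \<or> y' + b \<le> y)"
  using assms unfolding free_def
  by (auto simp: square_subset_strip_iff non_overlapping_iff)

lemma top_le_height: "((x, y), b) \<in> set P \<Longrightarrow> y + b \<le> height P"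
  unfolding height_def by (rule Max_ge) (simp, force)

lemma height_nonneg: "0 \<le> height P"
  unfolding height_def by (rule Max_ge) auto

lemma reachable_free: "p \<in> reachable P a \<Longrightarrow> free P a p"
  unfolding reachable_def using pathfinish_in_path_image by blast

lemma reachable_nonempty:
  assumes "0 < a" "a \<le> 1"
  shows "(0, height P) \<in> reachable P a"
proof -
  let ?g = "linepath (0 :: real, height P) (0, height P)"
  have "free P a (0, height P)"
    using assms by (auto simp: free_iff height_nonneg dest!: top_le_height)
  then have "path ?g \<and> height P \<le> snd (pathstart ?g) \<and> pathfinish ?g = (0, height P) \<and>
     (\<forall>q\<in>path_image ?g. free P a q) \<and> antimono_on {0..1} (\<lambda>t. snd (?g t))"
    by (auto simp: monotone_on_def linepath_refl path_const pathstart_def pathfinish_def)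
  then show ?thesis unfolding reachable_def by blast
qed

lemma reachable_extend:
  assumes p: "p \<in> reachable P a" and le: "snd q \<le> snd p"
    and fr: "\<And>r. r \<in> closed_segment p q \<Longrightarrow> free P a r"
  shows "q \<in> reachable P a"
proof -
  obtain g where g: "path g" "height P \<le> snd (pathstart g)" "pathfinish g = p"
    "\<forall>q\<in>path_image g. free P a q" "antimono_on {0..1} (\<lambda>t. snd (g t))"
    using p unfolding reachable_def by blast
  let ?h = "g +++ linepath p q"
  have lin: "snd (linepath p q t) \<le> snd (linepath p q s)" if "s \<le> t" for s t
  proof -
    have "snd (linepath p q s) - snd (linepath p q t) = (t - s) * (snd p - snd q)"
      by (simp add: linepath_def algebra_simps)
    also have "\<dots> \<ge> 0" using that le by simp
    finally show ?thesis by simp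
  qed
  have g_ge: "snd p \<le> snd (g t)" if "t \<in> {0..1}" for t
    using g(3,5) that unfolding monotone_on_def pathfinish_def
    by (metis atLeastAtMost_iff order.refl zero_le_one)
  have "antimono_on {0..1} (\<lambda>t. snd (?h t))"
  proof (rule monotone_onI)
    fix s t :: real assume st: "s \<in> {0..1}" "t \<in> {0..1}" "s \<le> t"
    consider "t \<le> 1/2" | "s \<le> 1/2" "1/2 < t" | "1/2 < s" by linarith
    then show "snd (?h t) \<le> snd (?h s)"
    proof cases
      case 1
      then have "snd (g (2 * t)) \<le> snd (g (2 * s))"
        using st by (intro monotone_onD[OF g(5)]) auto
      with 1 st show ?thesis by (simp add: joinpaths_def)
    next
      case 2
      have "snd (linepath p q (2 * t - 1)) \<le> snd (linepath p q 0)"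
        using 2 by (intro lin) auto
      also have "\<dots> = snd p" by (simp add: linepath_def)
      also have "\<dots> \<le> snd (g (2 * s))" using 2 st by (intro g_ge) auto
      finally show ?thesis using 2 by (simp add: joinpaths_def)
    next
      case 3
      then show ?thesis using st by (auto simp: joinpaths_def intro!: lin)
    qed
  qed
  moreover have "path ?h" "pathstart ?h = pathstart g" "pathfinish ?h = q"
    "\<forall>q\<in>path_image ?h. free P a q"
    using g fr by (auto simp: path_image_join)
  ultimately show ?thesis using g(2) unfolding reachable_def by auto
qed

lemma closed_segment_vertical:
  "r \<in> closed_segment (x, y) (x, y') \<Longrightarrow> y' \<le> y \<Longrightarrow> \<exists>z. r = (x, z) \<and> y' \<le> z \<and> z \<le> (y::real)"
  for x :: real
proof (rule exI[of _ "snd r"])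
  assume r: "r \<in> closed_segment (x, y) (x, y')" and "y' \<le> y"
  have "fst r = x" "snd r \<in> closed_segment y y'"
    using r closed_segment_PairD[of "fst r" "snd r"] by fastforce+
  with \<open>y' \<le> y\<close> show "r = (x, snd r) \<and> y' \<le> snd r \<and> snd r \<le> y"
    by (auto simp: closed_segment_eq_real_ivl split: if_splits)
qed

lemma closed_segment_horizontal:
  "r \<in> closed_segment (x, y) (x', y) \<Longrightarrow> x' \<le> x \<Longrightarrow> \<exists>z. r = (z, y) \<and> x' \<le> z \<and> z \<le> (x::real)"
  for y :: real
proof (rule exI[of _ "fst r"])
  assume r: "r \<in> closed_segment (x, y) (x', y)" and "x' \<le> x"
  have "snd r = y" "fst r \<in> closed_segment x x'"
    using r closed_segment_PairD[of "fst r" "snd r"] by fastforce+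
  with \<open>x' \<le> x\<close> show "r = (fst r, y) \<and> x' \<le> fst r \<and> fst r \<le> x"
    by (auto simp: closed_segment_eq_real_ivl split: if_splits)
qed

lemma move_down:
  assumes a: "0 < a" and p: "(x, y) \<in> reachable P a"
    and u: "0 \<le> u" "u \<le> y"
    and crit: "\<And>x' y' b. ((x', y'), b) \<in> set P \<Longrightarrow> y' + b \<le> y \<Longrightarrow>
      y' + b \<le> u \<or> b \<le> 0 \<or> x + a \<le> x' \<or> x' + b \<le> x"
  shows "(x, u) \<in> reachable P a"
proof (rule reachable_extend[OF p])
  fix r assume "r \<in> closed_segment (x, y) (x, u)"
  then obtain z where z: "r = (x, z)" "u \<le> z" "z \<le> y"
    using closed_segment_vertical u by blast
  show "free P a r"
    using reachable_free[OF p] z u crit unfolding z(1) free_iff[OF a] by fastforce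
qed (use u in simp)

lemma move_left:
  assumes a: "0 < a" and p: "(x, y) \<in> reachable P a"
    and u: "0 \<le> u" "u \<le> x"
    and crit: "\<And>x' y' b. ((x', y'), b) \<in> set P \<Longrightarrow> x' + b \<le> x \<Longrightarrow> x' + b \<le> u"
  shows "(u, y) \<in> reachable P a"
proof (rule reachable_extend[OF p])
  fix r assume "r \<in> closed_segment (x, y) (u, y)"
  then obtain z where z: "r = (z, y)" "u \<le> z" "z \<le> x"
    using closed_segment_horizontal u by blast
  show "free P a r"
    using reachable_free[OF p] z u crit unfolding z(1) free_iff[OF a] by fastforce
qed simp

text \<open>Only finitely many heights and abscissae are candidates for the chosen position:
  otherwise the square can move further down or to the left.\<close>

lemma bottom_left_exists:
  assumes a: "0 < a" "a \<le> 1"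
  shows "\<exists>p. is_bottom_left P a p"
proof -
  define R where "R = reachable P a"
  define Y where "Y = insert 0 ((\<lambda>((x', y'), b). y' + b) ` set P)"
  define X where "X = insert 0 ((\<lambda>((x', y'), b). x' + b) ` set P)"
  have fin: "finite Y" "finite X" by (auto simp: X_def Y_def)
  have Y_in: "y' + b \<in> Y" and X_in: "x' + b \<in> X" if "((x', y'), b) \<in> set P" for x' y' b
    using that by (force simp: X_def Y_def)+
  have nonneg: "0 \<le> x" "0 \<le> y" if "(x, y) \<in> R" for x y
    using reachable_free[of "(x, y)" P a] that a(1) by (simp_all add: R_def free_iff)
  have down: "\<exists>u\<in>Y. u \<le> y \<and> (x, u) \<in> R" if xy: "(x, y) \<in> R" for x y
  proof -
    define u where "u = Max {c\<in>Y. c \<le> y}"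
    have ne: "0 \<in> {c\<in>Y. c \<le> y}" using nonneg[OF xy] by (auto simp: Y_def)
    have u: "u \<in> Y" "u \<le> y"
    proof -
      have "u \<in> {c\<in>Y. c \<le> y}"
        unfolding u_def by (rule Max_in) (use fin ne in \<open>simp, blast\<close>)
      then show "u \<in> Y" "u \<le> y" by blast+
    qed
    have ge: "c \<le> u" if "c \<in> Y" "c \<le> y" for c
      unfolding u_def by (rule Max_ge) (use fin that in simp_all)
    have "(x, u) \<in> reachable P a"
    proof (rule move_down[OF a(1)])
      show "(x, y) \<in> reachable P a" using xy by (simp add: R_def)
      show "0 \<le> u" using ge ne by blast
    qed (use u ge Y_in in blast)+
    with u show ?thesis unfolding R_def by blast
  qed
  have left: "\<exists>u\<in>X. u \<le> x \<and> (u, y) \<in> R" if xy: "(x, y) \<in> R" for x y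
  proof -
    define u where "u = Max {c\<in>X. c \<le> x}"
    have ne: "0 \<in> {c\<in>X. c \<le> x}" using nonneg[OF xy] by (auto simp: X_def)
    have u: "u \<in> X" "u \<le> x"
    proof -
      have "u \<in> {c\<in>X. c \<le> x}"
        unfolding u_def by (rule Max_in) (use fin ne in \<open>simp, blast\<close>)
      then show "u \<in> X" "u \<le> x" by blast+
    qed
    have ge: "c \<le> u" if "c \<in> X" "c \<le> x" for c
      unfolding u_def by (rule Max_ge) (use fin that in simp_all)
    have "(u, y) \<in> reachable P a"
    proof (rule move_left[OF a(1)])
      show "(x, y) \<in> reachable P a" using xy by (simp add: R_def)
      show "0 \<le> u" using ge ne by blast
    qed (use u ge X_in in blast)+
    with u show ?thesis unfolding R_def by blast
  qed
  define y0 where "y0 = Min {c\<in>Y. \<exists>x. (x, c) \<in> R}"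
  have "(0, height P) \<in> R" unfolding R_def by (rule reachable_nonempty[OF a])
  from down[OF this] have "{c\<in>Y. \<exists>x. (x, c) \<in> R} \<noteq> {}" by blast
  then have "y0 \<in> {c\<in>Y. \<exists>x. (x, c) \<in> R}"
    unfolding y0_def using fin by (intro Min_in) auto
  then obtain x1 where x1: "(x1, y0) \<in> R" by blast
  have y0_le: "y0 \<le> y" if "(x, y) \<in> R" for x y
  proof -
    obtain u where u: "u \<in> Y" "u \<le> y" "(x, u) \<in> R" using down[OF \<open>(x, y) \<in> R\<close>] by blast
    have "y0 \<le> u" unfolding y0_def using fin u by (intro Min_le) auto
    with u show ?thesis by simp
  qed
  define x0 where "x0 = Min {c\<in>X. (c, y0) \<in> R}"
  have "{c\<in>X. (c, y0) \<in> R} \<noteq> {}" using left[OF x1] by blast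
  then have x0: "(x0, y0) \<in> R"
    unfolding x0_def using fin Min_in[of "{c\<in>X. (c, y0) \<in> R}"] by auto
  have x0_le: "x0 \<le> x" if "(x, y0) \<in> R" for x
  proof -
    obtain u where u: "u \<in> X" "u \<le> x" "(u, y0) \<in> R" using left[OF \<open>(x, y0) \<in> R\<close>] by blast
    have "x0 \<le> u" unfolding x0_def using fin u by (intro Min_le) auto
    with u show ?thesis by simp
  qed
  have "is_bottom_left P a (x0, y0)"
    using x0 x0_le y0_le by (auto simp: is_bottom_left_def R_def)
  then show ?thesis by blast
qed

lemma is_bottom_left_unique:
  "is_bottom_left P a p \<Longrightarrow> is_bottom_left P a q \<Longrightarrow> p = q"
  unfolding is_bottom_left_def by (rule prod_eqI) (simp_all add: order.antisym)

lemma is_bottom_left_bottom_left: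
  assumes "0 < a" "a \<le> 1"
  shows "is_bottom_left P a (bottom_left P a)"
proof -
  obtain p where p: "is_bottom_left P a p" using bottom_left_exists[OF assms] by blast
  show ?thesis
    unfolding bottom_left_def using p is_bottom_left_unique[OF _ p] by (rule theI)
qed

lemma is_bottom_left_supported:
  assumes a: "0 < a" and bl: "is_bottom_left P a p"
  shows "supported P (p, a)"
proof (rule ccontr)
  assume ns: "\<not> supported P (p, a)"
  obtain x y where p: "p = (x, y)" by (cases p)
  have xy: "(x, y) \<in> reachable P a" using bl p by (simp add: is_bottom_left_def)
  then have fr: "free P a (x, y)" by (rule reachable_free)
  have y: "0 < y"
  proof (rule ccontr)
    assume "\<not> 0 < y"
    then have "bottom_side (p, a) \<subseteq> strip_bottom"
      using fr a by (auto simp: free_iff p bottom_side_def strip_bottom_def)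
    with ns show False by (simp add: supported_def)
  qed
  have gap: "b \<le> 0 \<or> x + a \<le> x' \<or> x' + b \<le> x"
    if t: "((x', y'), b) \<in> set P" and eq: "y' + b = y" for x' y' b
  proof (rule ccontr)
    assume c: "\<not> ?thesis"
    define l r where "l = max x x'" and "r = min (x + a) (x' + b)"
    have lr: "l < r" using c a by (auto simp: l_def r_def)
    have "bottom_side (p, a) \<inter> top_side ((x', y'), b) = {l..r} \<times> {y}"
      using eq by (auto simp: p bottom_side_def top_side_def l_def r_def)
    also have "\<dots> = closed_segment (l, y) (r, y)"
    proof -
      have "closed_segment (l, y) (r, y) = (\<lambda>z. (z, y)) ` closed_segment l r"
        unfolding linepath_image_01[symmetric] image_image
        by (rule image_cong) (simp_all add: linepath_def algebra_simps)
      then show ?thesis using lr by (auto simp: closed_segment_eq_real_ivl)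
    qed
    finally have "bottom_side (p, a) \<inter> top_side ((x', y'), b) = closed_segment (l, y) (r, y)" .
    then have "\<exists>t\<in>set P. \<exists>u v. u \<noteq> v \<and>
        bottom_side (p, a) \<inter> top_side t = closed_segment u v"
      using lr t by (intro bexI[of _ "((x', y'), b)"] exI[of _ "(l, y)"] exI[of _ "(r, y)"]) auto
    with ns show False unfolding supported_def by blast
  qed
  define Y where "Y = {c \<in> insert 0 ((\<lambda>((x', y'), b). y' + b) ` set P). c < y}"
  define u where "u = Max Y"
  have fin: "finite Y" and zero: "0 \<in> Y" using y by (auto simp: Y_def)
  have "u \<in> Y" unfolding u_def using fin zero by (intro Max_in) auto
  then have uy: "u < y" by (simp add: Y_def)
  have ge: "c \<le> u" if "c \<in> Y" for c unfolding u_def using fin that by (intro Max_ge)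
  have "(x, u) \<in> reachable P a"
  proof (rule move_down[OF a xy])
    fix x' y' b assume t: "((x', y'), b) \<in> set P" and le: "y' + b \<le> y"
    show "y' + b \<le> u \<or> b \<le> 0 \<or> x + a \<le> x' \<or> x' + b \<le> x"
    proof (cases "y' + b = y")
      case True
      then show ?thesis using gap[OF t] by blast
    next
      case False
      then have "y' + b \<in> Y" using t le by (force simp: Y_def)
      then show ?thesis using ge by blast
    qed
  qed (use uy ge zero in auto)
  then have "y \<le> u" using bl p by (force simp: is_bottom_left_def)
  with uy show False by simp
qed

lemma online_strategy_bottom_left: "online_strategy bottom_left"
  unfolding online_strategy_def
proof (intro allI impI)
  fix as a assume "valid_input (as @ [a])"
  then have "0 < a" "a \<le> 1" by (auto simp: valid_input_def)
  then have bl: "is_bottom_left (run bottom_left as) a (bottom_left (run bottom_left as) a)"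
    by (rule is_bottom_left_bottom_left)
  show "bottom_left (run bottom_left as) a \<in> reachable (run bottom_left as) a \<and>
        supported (run bottom_left as) (bottom_left (run bottom_left as) a, a)"
    using bl is_bottom_left_supported[OF \<open>0 < a\<close> bl] by (simp add: is_bottom_left_def)
qed

end

theory Submission
  imports Defs
begin

text \<open>
  Drop a final unit square onto the packing; its bottom is at least as high as the packing. The free
  area below it is at most \<open>5 / 2\<close> times the total area of all squares, the unit square included,
  and this is shown by charging. Let \<open>p\<close> be a free point, \<open>T\<close> the first square above \<open>p\<close>, and
  \<open>S\<close> the rightmost square supporting \<open>T\<close>.

  If \<open>p\<close> lies to the left of \<open>S\<close>, following left neighbours from \<open>S\<close> shows that \<open>p\<close> is above
  the diagonal descending to the left from the lower left corner of \<open>S\<close>. With side \<open>s\<close> of \<open>S\<close> and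
  \<open>w\<close> the length by which \<open>T\<close> sticks out to the left of \<open>S\<close>, such points fill an area of at most
  \<open>s * w + w\<^sup>2 / 2\<close>.

  Otherwise \<open>p\<close> lies below a right overhang of \<open>T\<close>. It is charged to a square whose right side it faces
  at a distance of at most the side length (total charge: one area per square), or else to an
  overhanging square \<open>B\<close>, placed no later than \<open>T\<close>, such that below \<open>B\<close> the left boundary of the free space above \<open>p\<close>
  only moves to the right when going down. The points of the second kind charged to \<open>B\<close> fill
  at most half of the area of \<open>B\<close>: a channel of width \<open>w\<close> next to a square of side \<open>u < w\<close>
  contributes \<open>u * (w - u)\<close> and below that square splits into channels of width at most \<open>u\<close>, since
  the square was not placed deeper; by induction the total is at most \<open>w\<^sup>2 / 2\<close>.

  In total, a square with a right overhang has \<open>s + w\<close> at most its side length \<open>t\<close>, so both kinds of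
  charges to its bottom amount to at most \<open>t\<^sup>2\<close>; one without is charged at most \<open>t\<^sup>2\<close>
  and another \<open>s\<^sup>2 / 2\<close> goes to \<open>S\<close>.
\<close>

section \<open>Bounds on outer area\<close>

text \<open>An outer measure bound: a measurable cover suffices, so the sets of free points need not
  be shown measurable.\<close>

definition cov :: "(real \<times> real) set \<Rightarrow> real \<Rightarrow> bool" where
  "cov M m \<longleftrightarrow> (\<exists>C\<in>sets lborel. M \<subseteq> C \<and> emeasure lborel C \<le> ennreal m)"

lemma cov_mono: "cov M m \<Longrightarrow> M' \<subseteq> M \<Longrightarrow> m \<le> m' \<Longrightarrow> cov M' m'"
  unfolding cov_def using order_trans[OF _ ennreal_leI] by blast

lemma cov_empty: "cov {} 0"
  unfolding cov_def by (intro bexI[of _ "{}"]) auto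

lemma cov_Un:
  assumes "cov M a" "cov N b" "0 \<le> a" "0 \<le> b"
  shows "cov (M \<union> N) (a + b)"
proof -
  obtain C D where "C \<in> sets lborel" "M \<subseteq> C" "emeasure lborel C \<le> ennreal a"
    "D \<in> sets lborel" "N \<subseteq> D" "emeasure lborel D \<le> ennreal b"
    using assms(1,2) unfolding cov_def by blast
  moreover from this have "emeasure lborel (C \<union> D) \<le> ennreal a + ennreal b"
    using emeasure_subadditive[of C lborel D] by (meson add_mono order_trans)
  ultimately show ?thesis
    unfolding cov_def using assms(3,4) by (intro bexI[of _ "C \<union> D"] conjI Un_mono) simp_all
qed

lemma cov_UN:
  assumes "finite I" "\<And>i. i \<in> I \<Longrightarrow> cov (M i) (m i)" "\<And>i. i \<in> I \<Longrightarrow> 0 \<le> m i"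
  shows "cov (\<Union>i\<in>I. M i) (\<Sum>i\<in>I. m i)"
  using assms
proof (induction I rule: finite_induct)
  case (insert i I)
  then have "cov (M i \<union> (\<Union>i\<in>I. M i)) (m i + (\<Sum>i\<in>I. m i))"
    by (intro cov_Un sum_nonneg) simp_all
  with insert show ?case by simp
qed (simp add: cov_empty)

lemma emeasure_rectangle:
  fixes a b c d :: real
  assumes "a \<le> b" "c \<le> d"
  shows "emeasure lborel ({a..b} \<times> {c..d}) = ennreal ((b - a) * (d - c))"
proof -
  have "emeasure lborel ({a..b} \<times> {c..d}) = emeasure lborel {a..b} * emeasure lborel {c..d}"
    unfolding lborel_prod[symmetric] by (rule lborel.emeasure_pair_measure_Times) simp_all
  then show ?thesis using assms by (simp add: ennreal_mult')
qed

lemma cov_rectangle: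
  assumes "a \<le> b" "c \<le> d"
  shows "cov ({a..b} \<times> {c..d}) ((b - a) * (d - c))"
  unfolding cov_def
proof (intro bexI[of _ "{a..b} \<times> {c..d}"] conjI)
  show "{a..b} \<times> {c..d} \<in> sets lborel"
    by (simp add: borel_closed closed_Times)
qed (use assms in \<open>simp_all add: emeasure_rectangle\<close>)

lemma cov_vertical_line: "cov ({c} \<times> UNIV) 0"
proof -
  have "emeasure lborel ({c} \<times> (UNIV :: real set)) = emeasure lborel {c} * emeasure lborel (UNIV :: real set)" for c :: real
    unfolding lborel_prod[symmetric] by (rule lborel.emeasure_pair_measure_Times) simp_all
  moreover have "{c} \<times> (UNIV :: real set) \<in> sets lborel"
    by (simp add: borel_closed closed_Times)
  ultimately show ?thesis unfolding cov_def by (intro bexI[of _ "{c} \<times> UNIV"] conjI) simp_all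
qed

lemma cov_horizontal_line: "cov (UNIV \<times> {c}) 0"
proof -
  have "emeasure lborel ((UNIV :: real set) \<times> {c}) = emeasure lborel (UNIV :: real set) * emeasure lborel {c}" for c :: real
    unfolding lborel_prod[symmetric] by (rule lborel.emeasure_pair_measure_Times) simp_all
  moreover have "(UNIV :: real set) \<times> {c} \<in> sets lborel"
    by (simp add: borel_closed closed_Times)
  ultimately show ?thesis unfolding cov_def by (intro bexI[of _ "UNIV \<times> {c}"] conjI) simp_all
qed

lemma cov_rectangle_le:
  assumes "cov ({0..1} \<times> {0..h}) m" "0 \<le> m" "0 \<le> h"
  shows "h \<le> m"
proof -
  obtain C :: "(real \<times> real) set" where
    C: "C \<in> sets lborel" "{0..1} \<times> {0..h} \<subseteq> C" "emeasure lborel C \<le> ennreal m"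
    using assms(1) unfolding cov_def by blast
  have "ennreal h = emeasure lborel ({0..1 :: real} \<times> {0..h})"
    using assms(3) by (simp add: emeasure_rectangle)
  also have "\<dots> \<le> emeasure lborel C" using C(2,1) by (rule emeasure_mono)
  also have "\<dots> \<le> ennreal m" by (rule C(3))
  finally show ?thesis using assms(2) by (simp only: ennreal_le_iff)
qed

lemma cov_trapezoid:
  assumes "0 \<le> s" "0 \<le> w"
  shows "cov {(x, y). l \<le> x \<and> x \<le> l + w \<and> c - s - (l + w - x) \<le> y \<and> y \<le> c} (s * w + w\<^sup>2 / 2)"
proof -
  let ?T = "{(x, y). l \<le> x \<and> x \<le> l + w \<and> c - s - (l + w - x) \<le> y \<and> y \<le> c}"
  have "closed ?T"
    unfolding case_prod_unfold
    by (intro closed_Collect_conj closed_Collect_le continuous_intros)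
  then have meas: "?T \<in> sets lborel" by (simp add: borel_closed)
  have "emeasure lborel ?T = (\<integral>\<^sup>+x. emeasure lborel (Pair x -` ?T) \<partial>lborel)"
    using meas unfolding lborel_prod[symmetric] by (rule lborel.emeasure_pair_measure_alt)
  also have "\<dots> = (\<integral>\<^sup>+x. ennreal (s + (l + w - x)) * indicator {l..l + w} x \<partial>lborel)"
  proof (rule nn_integral_cong)
    fix x
    have "Pair x -` ?T = (if x \<in> {l..l + w} then {c - s - (l + w - x)..c} else {})"
      by auto
    then show "emeasure lborel (Pair x -` ?T) = ennreal (s + (l + w - x)) * indicator {l..l + w} x"
      using assms by (auto simp: algebra_simps)
  qed
  \<comment> \<open>The antiderivative is \<open>s * x - (l + w - x)\<^sup>2 / 2\<close>.\<close>
  also have "\<dots> = ennreal ((s * (l + w) - (l + w - (l + w))\<^sup>2 / 2) - (s * l - (l + w - l)\<^sup>2 / 2))"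
    using assms
    by (intro nn_integral_FTC_Icc) (auto intro!: derivative_eq_intros, simp add: field_simps)
  also have "\<dots> = ennreal (s * w + w\<^sup>2 / 2)"
    by (simp add: algebra_simps)
  finally show ?thesis unfolding cov_def using meas by (intro bexI[of _ ?T] conjI) simp_all
qed

section \<open>Sums over disjoint intervals and sums of squares\<close>

lemma sum_disjoint_intervals_le:
  fixes l a :: "'i \<Rightarrow> real"
  assumes fin: "finite K" and nn: "\<And>k. k \<in> K \<Longrightarrow> 0 \<le> a k" and w: "0 \<le> w"
    and sub: "\<And>k. k \<in> K \<Longrightarrow> c \<le> l k \<and> l k + a k \<le> c + w"
    and dis: "\<And>j k. j \<in> K \<Longrightarrow> k \<in> K \<Longrightarrow> j \<noteq> k \<Longrightarrow> l j + a j \<le> l k \<or> l k + a k \<le> l j"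
  shows "(\<Sum>k\<in>K. a k) \<le> w"
proof -
  let ?I = "\<lambda>k. {l k<..<l k + a k}"
  have "ennreal (\<Sum>k\<in>K. a k) = (\<Sum>k\<in>K. emeasure lborel (?I k))"
    using nn by (simp add: sum_ennreal)
  also have "\<dots> = emeasure lborel (\<Union>k\<in>K. ?I k)"
  proof (rule sum_emeasure)
    show "disjoint_family_on ?I K"
      unfolding disjoint_family_on_def using dis by fastforce
  qed (use fin in auto)
  also have "\<dots> \<le> emeasure lborel {c..c + w}"
    using sub by (intro emeasure_mono) force+
  also have "\<dots> = ennreal w" using w by simp
  finally show ?thesis using w by simp
qed

text \<open>Let \<open>m\<close> be the largest term. If \<open>w \<le> 2 * m\<close>, the others
  sum to at most \<open>w - m\<close>, and \<open>m\<^sup>2 + (w - m)\<^sup>2\<close> increases for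
  \<open>m \<ge> w / 2\<close>. Otherwise the sum is at most \<open>m * w\<close>, below
  \<open>w\<^sup>2 / 2\<close>, the minimum of the right side. Adding \<open>2 * u * (w - u)\<close>
  to the bound gives exactly \<open>w\<^sup>2\<close>.\<close>

lemma sum_squares_le_of_bounded:
  fixes a :: "'i \<Rightarrow> real"
  assumes fin: "finite K" and nn: "\<And>k. k \<in> K \<Longrightarrow> 0 \<le> a k" and le: "\<And>k. k \<in> K \<Longrightarrow> a k \<le> u"
    and sum: "(\<Sum>k\<in>K. a k) \<le> w" and u: "0 \<le> u" "u \<le> w"
  shows "(\<Sum>k\<in>K. (a k)\<^sup>2) \<le> u\<^sup>2 + (w - u)\<^sup>2"
proof (cases "K = {}")
  case True
  then show ?thesis by simp
next
  case False
  define m where "m = Max (a ` K)"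
  have m_ge: "a k \<le> m" if "k \<in> K" for k using that fin by (simp add: m_def)
  have "m \<in> a ` K" unfolding m_def using fin False by (intro Max_in) auto
  then obtain k0 where k0: "k0 \<in> K" "a k0 = m" by auto
  have m: "0 \<le> m" "m \<le> u" using k0 nn le by auto
  have sq: "(\<Sum>k\<in>J. (a k)\<^sup>2) \<le> m * (\<Sum>k\<in>J. a k)" if "J \<subseteq> K" for J
    unfolding sum_distrib_left power2_eq_square
    using that m_ge nn by (intro sum_mono mult_right_mono) auto
  show ?thesis
  proof (cases "w \<le> 2 * m")
    case True
    have rest: "(\<Sum>k\<in>K - {k0}. a k) \<le> w - m"
      using sum fin k0 by (simp add: sum_diff1)
    have rest_nn: "0 \<le> (\<Sum>k\<in>K - {k0}. a k)" using nn by (intro sum_nonneg) auto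
    have ak: "a k \<le> w - m" if "k \<in> K - {k0}" for k
      using rest member_le_sum[of k "K - {k0}" a] that nn fin by fastforce
    have "(\<Sum>k\<in>K - {k0}. (a k)\<^sup>2) \<le> (\<Sum>k\<in>K - {k0}. (w - m) * a k)"
      unfolding power2_eq_square using ak nn by (intro sum_mono mult_right_mono) auto
    also have "\<dots> \<le> (w - m) * (w - m)"
      unfolding sum_distrib_left[symmetric] using rest m u by (intro mult_left_mono) auto
    finally have "(\<Sum>k\<in>K. (a k)\<^sup>2) \<le> m\<^sup>2 + (w - m)\<^sup>2"
      using fin k0 by (simp add: sum.remove[of K k0] power2_eq_square)
    also have "\<dots> \<le> u\<^sup>2 + (w - u)\<^sup>2"
    proof -
      have "0 \<le> 2 * ((u - m) * (u + m - w))" using True m by (intro mult_nonneg_nonneg) auto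
      then show ?thesis by (simp add: power2_eq_square algebra_simps)
    qed
    finally show ?thesis .
  next
    case False
    have "(\<Sum>k\<in>K. (a k)\<^sup>2) \<le> m * w"
      using sq[of K] mult_left_mono[OF sum m(1)] by simp
    also have "\<dots> \<le> w / 2 * w" using False u by (intro mult_right_mono) auto
    also have "\<dots> \<le> u\<^sup>2 + (w - u)\<^sup>2"
      using zero_le_power2[of "2 * u - w"] by (simp add: power2_eq_square algebra_simps)
    finally show ?thesis .
  qed
qed

lemma ex_min_real:
  fixes f :: "'a \<Rightarrow> real"
  assumes "finite S" "x \<in> S"
  obtains z where "z \<in> S" "\<And>w. w \<in> S \<Longrightarrow> f z \<le> f w"
  using assms arg_min_if_finite(1)[of S f] arg_min_least[of S _ f] by blast

section \<open>Free area in a BottomLeft packing\<close>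

text \<open>In \<open>slide_and_drop\<close> the square \<open>i\<close> can slide to the right until its left side is at \<open>\<xi>\<close>.
  The smaller square \<open>j\<close>, placed no later than \<open>i\<close>, fits on the way of \<open>i\<close>, so that it could have
  followed \<open>i\<close> and then dropped to height \<open>y\<close>.\<close>

locale bottom_left_packing =
  fixes n :: nat and X Y A :: "nat \<Rightarrow> real"
  assumes side_pos: "i < n \<Longrightarrow> 0 < A i"
    and in_strip: "i < n \<Longrightarrow> 0 \<le> X i \<and> X i + A i \<le> 1 \<and> 0 \<le> Y i"
    and disjoint: "i < n \<Longrightarrow> j < n \<Longrightarrow> i \<noteq> j \<Longrightarrow>
      X i + A i \<le> X j \<or> X j + A j \<le> X i \<or> Y i + A i \<le> Y j \<or> Y j + A j \<le> Y i"
    and left_neighbour: "i < n \<Longrightarrow> X i \<noteq> 0 \<Longrightarrow>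
      \<exists>j<i. X j + A j = X i \<and> Y j < Y i + A i \<and> Y i < Y j + A j"
    and support: "i < n \<Longrightarrow> Y i \<noteq> 0 \<Longrightarrow>
      \<exists>j<i. Y j + A j = Y i \<and> X j < X i + A i \<and> X i < X j + A j"
    and slide_and_drop: "j \<le> i \<Longrightarrow> i < n \<Longrightarrow> A j \<le> A i \<Longrightarrow> X i \<le> \<xi> \<Longrightarrow> \<xi> + A i \<le> 1 \<Longrightarrow>
      (\<And>k. k < i \<Longrightarrow> \<not> (X k < \<xi> + A i \<and> X i < X k + A k \<and> Y k < Y i + A i \<and> Y i < Y k + A k)) \<Longrightarrow>
      \<xi> \<le> x \<Longrightarrow> x + A j \<le> \<xi> + A i \<Longrightarrow> 0 \<le> y \<Longrightarrow> y \<le> Y i \<Longrightarrow>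
      (\<And>k. k < j \<Longrightarrow> \<not> (X k < x + A j \<and> x < X k + A k \<and> Y k < Y i \<and> y < Y k + A k)) \<Longrightarrow>
      Y j \<le> y"
begin

definition right :: "nat \<Rightarrow> real" where "right i = X i + A i"

definition top :: "nat \<Rightarrow> real" where "top i = Y i + A i"

definition supports :: "nat \<Rightarrow> nat set" where
  "supports i = {k. k < i \<and> top k = Y i \<and> X k < right i \<and> X i < right k}"

definition last_support :: "nat \<Rightarrow> nat" where
  "last_support i = (SOME k. k \<in> supports i \<and> (\<forall>j\<in>supports i. right j \<le> right k))"

text \<open>Excluding the lines that carry sides costs no area and makes every comparison of a point
  with a side strict.\<close>

definition generic :: "real \<Rightarrow> real \<Rightarrow> bool" where
  "generic x y \<longleftrightarrow> 0 < x \<and> x < 1 \<and> 0 < y \<and>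
     (\<forall>k<n. x \<noteq> X k \<and> x \<noteq> right k \<and> y \<noteq> Y k \<and> y \<noteq> top k)"

lemma right_gt: "i < n \<Longrightarrow> X i < right i"
  and top_gt: "i < n \<Longrightarrow> Y i < top i"
  using side_pos by (auto simp: right_def top_def)

lemma overlap_eq:
  "\<lbrakk>i < n; j < n; X i < right j; X j < right i; Y i < top j; Y j < top i\<rbrakk> \<Longrightarrow> i = j"
  using disjoint[of i j] unfolding right_def top_def by fastforce

lemma last_support:
  assumes "i < n" "Y i \<noteq> 0"
  shows "last_support i \<in> supports i" "\<And>j. j \<in> supports i \<Longrightarrow> right j \<le> right (last_support i)"
proof -
  have fin: "finite (supports i)" by (auto simp: supports_def)
  have ne: "supports i \<noteq> {}"
    using support[OF assms] by (auto simp: supports_def right_def top_def)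
  define m where "m = Max (right ` supports i)"
  have "m \<in> right ` supports i" unfolding m_def using fin ne by (intro Max_in) auto
  then obtain k where "k \<in> supports i" "right k = m" by auto
  moreover have "right j \<le> m" if "j \<in> supports i" for j
    unfolding m_def using that fin by (intro Max_ge) auto
  ultimately have "\<exists>k. k \<in> supports i \<and> (\<forall>j\<in>supports i. right j \<le> right k)" by blast
  from someI_ex[OF this, folded last_support_def]
  show "last_support i \<in> supports i" "\<And>j. j \<in> supports i \<Longrightarrow> right j \<le> right (last_support i)"
    by auto
qed

section \<open>Points to the left of the last support\<close>

text \<open>A chain of left neighbours from the last support stays on or above the diagonal until it
  crosses the abscissa \<open>x\<close>; the crossing square lies under \<open>T\<close>, so its top
  is not above the point.\<close>

lemma above_staircase:
  assumes T: "T < n" "Y T \<noteq> 0" and gen: "generic x y"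
    and x: "X T < x" "x < X (last_support T)"
    and line: "\<And>k. k < n \<Longrightarrow> X k < x \<Longrightarrow> x < right k \<Longrightarrow> Y k < Y T \<Longrightarrow> top k \<le> y"
  shows "Y (last_support T) - (X (last_support T) - x) \<le> y"
proof -
  let ?S = "last_support T"
  \<comment> \<open>Squares right of \<open>x\<close> with lower left corner on or above the
    diagonal. The left neighbour of the leftmost one crosses \<open>x\<close>.\<close>
  define C where "C = {i. i < n \<and> x < X i \<and> X i \<le> X ?S \<and> top i \<le> Y T \<and> Y ?S - X ?S \<le> Y i - X i}"
  have S: "?S < T" "top ?S = Y T" "X ?S < right T"
    using last_support(1)[OF T] by (auto simp: supports_def)
  have fin: "finite C" by (simp add: C_def)
  have "?S \<in> C" using S T x by (simp add: C_def)
  then obtain i where i: "i \<in> C" "\<And>j. j \<in> C \<Longrightarrow> X i \<le> X j"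
    using fin ex_min_if_finite[of "X ` C"] by (metis (no_types, lifting) arg_min_if_finite(1) arg_min_least empty_iff)
  have iD: "i < n" "x < X i" "X i \<le> X ?S" "top i \<le> Y T" "Y ?S - X ?S \<le> Y i - X i"
    using i(1) by (auto simp: C_def)
  have "0 < x" using gen by (simp add: generic_def)
  then obtain j where j: "j < i" "right j = X i" "Y j < top i" "Y i < top j"
    using left_neighbour[OF iD(1)] iD(2) unfolding right_def top_def by fastforce
  have jn: "j < n" using j iD by simp
  have topj: "top j \<le> Y T"
  proof (rule ccontr)
    assume "\<not> top j \<le> Y T"
    moreover have "X j < right j" "Y T < top T" using right_gt top_gt jn T by auto
    ultimately have "j = T" using j iD S x by (intro overlap_eq[OF jn T(1)]) auto
    then show False using j iD top_gt[of T] T by auto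
  qed
  \<comment> \<open>The lower left and upper right corners of a square lie on a line of slope 1, and
    the upper right corner of \<open>j\<close> is directly above the lower left corner of
    \<open>i\<close>.\<close>
  have diag: "Y ?S - X ?S \<le> Y j - X j"
    using j(2,4) iD(5) by (simp add: right_def top_def)
  have "\<not> x < X j"
  proof
    assume "x < X j"
    then have "j \<in> C" using jn topj diag right_gt[OF jn] j iD by (simp add: C_def)
    then show False using i(2)[of j] right_gt[OF jn] j by simp
  qed
  then have "X j < x" using gen jn by (auto simp: generic_def order.order_iff_strict not_less)
  then have "top j \<le> y"
    using line[OF jn] j iD topj top_gt[OF jn] by simp
  then show ?thesis using iD j by simp
qed

section \<open>Points below a right overhang\<close>

text \<open>The square \<open>B\<close>, slid to the right until it covers \<open>x\<close>, lies above the gap to the right of its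
  last support, and the vertical segment from \<open>(x, y)\<close> up to the level of \<open>B\<close> is free.\<close>

definition overhangs :: "nat \<Rightarrow> real \<Rightarrow> real \<Rightarrow> bool" where
  "overhangs B x y \<longleftrightarrow> B < n \<and> y < Y B \<and> right (last_support B) < right B \<and> right (last_support B) < x \<and>
     (\<forall>k<B. X k < x \<longrightarrow> x < right k \<longrightarrow> Y k < Y B \<longrightarrow> top k \<le> y) \<and>
     (\<forall>k<B. Y k < Y B \<longrightarrow> Y B \<le> top k \<longrightarrow> X k < x \<longrightarrow> right k \<le> right (last_support B)) \<and>
     (\<forall>k<B. \<not> (X k < x \<and> right B < right k \<and> Y k < top B \<and> Y B < top k))"

text \<open>Start of the descent to a settled square. A square reaching the level \<open>Y T\<close>
  beyond the last support would be a support further right or overlap \<open>T\<close>.\<close>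

lemma overhangs_lid:
  assumes T: "T < n" and gen: "generic x y" and y: "y < Y T"
    and x: "X (last_support T) < x" "x < right T"
    and line: "\<And>k. k < n \<Longrightarrow> X k < x \<Longrightarrow> x < right k \<Longrightarrow> Y k < Y T \<Longrightarrow> top k \<le> y"
  shows "overhangs T x y"
proof -
  let ?S = "last_support T"
  have Y: "Y T \<noteq> 0" using gen y by (auto simp: generic_def)
  have S: "?S < T" "top ?S = Y T" "X ?S < right T" "X T < right ?S"
    using last_support(1)[OF T Y] by (auto simp: supports_def)
  have Sn: "?S < n" using S T by simp
  have "\<not> x < right ?S"
    using line[OF Sn x(1)] S y top_gt[OF Sn] by auto
  then have rS: "right ?S < x" using gen Sn by (auto simp: generic_def not_less order.order_iff_strict)
  have gap: "right k \<le> right ?S" if k: "k < T" "Y k < Y T" "Y T \<le> top k" "X k < x" for k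
  proof (rule ccontr)
    assume c: "\<not> right k \<le> right ?S"
    have kn: "k < n" using k T by simp
    have "top k = Y T"
    proof (rule ccontr)
      assume "top k \<noteq> Y T"
      then have "k = T" using k c S x top_gt[OF T] by (intro overlap_eq[OF kn T]) auto
      then show False using k by simp
    qed
    then have "k \<in> supports T" using k c S x by (auto simp: supports_def)
    then show False using last_support(2)[OF T Y] c by simp
  qed
  have "\<not> (X k < x \<and> right T < right k \<and> Y k < top T \<and> Y T < top k)" if "k < T" for k
  proof
    assume "X k < x \<and> right T < right k \<and> Y k < top T \<and> Y T < top k"
    then have "k = T" using that T x right_gt[OF T] by (intro overlap_eq[OF _ T]) auto
    then show False using that by simp
  qed
  then show ?thesis
    unfolding overhangs_def using T y rS x gap line by auto
qed

text \<open>No square to the left of the segment between \<open>(x, y)\<close> and the level of \<open>B\<close> overhangs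
  to the right: just below its bottom, some square extends at least as far towards \<open>x\<close>.\<close>

definition settled :: "nat \<Rightarrow> real \<Rightarrow> real \<Rightarrow> bool" where
  "settled B x y \<longleftrightarrow> overhangs B x y \<and>
     (\<forall>V<B. y < Y V \<longrightarrow> Y V < Y B \<longrightarrow> right (last_support B) \<le> right V \<longrightarrow> right V < x \<longrightarrow>
        (\<exists>k<B. Y k < Y V \<and> Y V \<le> top k \<and> right V \<le> right k \<and> right k < x))"

text \<open>If \<open>B\<close> is not settled, a violating square \<open>V\<close> overhangs the
  same point and was placed before \<open>B\<close>, so the descent ends.\<close>

lemma overhangs_imp_settled:
  assumes gen: "generic x y" and "overhangs B x y"
  shows "\<exists>B'. settled B' x y"
  using assms(2)
proof (induction B rule: less_induct)
  case (less B)
  note B = less.prems[unfolded overhangs_def]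
  show ?case
  proof (cases "settled B x y")
    case False
    let ?\<sigma> = "right (last_support B)"
    obtain V where V: "V < B" "y < Y V" "Y V < Y B" "?\<sigma> \<le> right V" "right V < x"
      and no: "\<And>k. k < B \<Longrightarrow> Y k < Y V \<Longrightarrow> Y V \<le> top k \<Longrightarrow> right V \<le> right k \<Longrightarrow> \<not> right k < x"
      using False less.prems unfolding settled_def by blast
    have Bn: "B < n" and Vn: "V < n" using B V by auto
    have y: "0 < y" using gen by (simp add: generic_def)
    have lineB: "top k \<le> y" if "k < B" "X k < x" "x < right k" "Y k < Y B" for k
      using B that by blast
    have gapB: "right k \<le> ?\<sigma>" if "k < B" "Y k < Y B" "Y B \<le> top k" "X k < x" for k
      using B that by blast
    \<comment> \<open>The segment above the point is free up to \<open>Y B\<close>, so squares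
      starting left of \<open>x\<close> and reaching above \<open>y\<close> also end left of
      \<open>x\<close>.\<close>
    have left_of: "right k < x" if "k < B" "X k < x" "Y k < Y B" "y < top k" for k
      using lineB[of k] that gen Bn unfolding generic_def by (meson less_trans not_less linorder_neqE)
    have no': "right k < right V" if "k < B" "Y k < Y V" "Y V \<le> top k" "X k < x" for k
      using no[of k] left_of[of k] that V by fastforce
    let ?S = "last_support V"
    have Y: "Y V \<noteq> 0" using V y by simp
    have S: "?S < V" "top ?S = Y V" "X ?S < right V" "X V < right ?S"
      using last_support(1)[OF Vn Y] by (auto simp: supports_def)
    have Sn: "?S < n" using S Vn by simp
    have rS: "right ?S < right V"
      using no'[of ?S] S V top_gt[OF Sn] by auto
    have gap: "right k \<le> right ?S" if k: "k < V" "Y k < Y V" "Y V \<le> top k" "X k < x" for k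
    proof (rule ccontr)
      assume c: "\<not> right k \<le> right ?S"
      have kn: "k < n" using k Vn by simp
      have kV: "right k < right V" using no' k V by simp
      then have XV: "X k < right V" using right_gt[OF kn] by simp
      have "top k = Y V"
      proof (rule ccontr)
        assume "top k \<noteq> Y V"
        then have "k = V" using k c S XV top_gt[OF Vn] by (intro overlap_eq[OF kn Vn]) auto
        then show False using k by simp
      qed
      then have "k \<in> supports V" using k c S XV by (auto simp: supports_def)
      then show False using last_support(2)[OF Vn Y] c by simp
    qed
    \<comment> \<open>Reaching above the bottom of \<open>B\<close>, \<open>V\<close> would have to
      be the last support of \<open>B\<close>, whose top is at that very level.\<close>
    have topV: "top V \<le> Y B"
    proof (rule ccontr)
      assume c: "\<not> top V \<le> Y B"
      have YB: "Y B \<noteq> 0" using B y by simp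
      have SB: "last_support B < B" "top (last_support B) = Y B"
        using last_support(1)[OF Bn YB] by (auto simp: supports_def)
      have SBn: "last_support B < n" using SB Bn by simp
      have "right V \<le> ?\<sigma>" using gapB[of V] V c right_gt[OF Vn] by simp
      then have "right V = ?\<sigma>" using V by simp
      then have "V = last_support B"
        using right_gt[OF Vn] right_gt[OF SBn] c SB V top_gt[OF SBn]
        by (intro overlap_eq[OF Vn SBn]) auto
      then show False using c SB by simp
    qed
    \<comment> \<open>A square blocking the way of \<open>V\<close> to the right rests on a lower
      one that also extends beyond the right side of \<open>V\<close>. Descending ends at a square
      below the bottom of \<open>V\<close>, against the choice of \<open>V\<close>; counting lower
      squares makes this well-founded.\<close>
    have slide: "\<not> (X k < x \<and> right V < right k \<and> Y k < top V \<and> Y V < top k)" if "k < B" for k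
      using that
    proof (induction "card {i. i < B \<and> Y i < Y k}" arbitrary: k rule: less_induct)
      case (less k)
      have kn: "k < n" using less.prems Bn by simp
      show ?case
      proof
        assume k: "X k < x \<and> right V < right k \<and> Y k < top V \<and> Y V < top k"
        have kB: "Y k < Y B" using k topV by simp
        have kx: "right k < x" using left_of[of k] less.prems k V kB by simp
        show False
        proof (cases "Y k < Y V")
          case True
          then show False using no'[of k] less.prems k by simp
        next
          case False
          have "Y k \<noteq> 0" using False V y by simp
          then obtain j where j: "j < k" "top j = Y k" "X j < right k" "X k < right j"
            using support[OF kn] unfolding right_def top_def by blast
          have jn: "j < n" and jB: "j < B" using j kn less.prems by auto
          have "right V \<le> X k"
          proof (rule ccontr)
            assume "\<not> right V \<le> X k"
            then have "k = V"
              using k right_gt[OF Vn] by (intro overlap_eq[OF kn Vn]) auto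
            then show False using k by simp
          qed
          then have rj: "right V < right j" using j by simp
          have Yj: "Y j < Y k" using top_gt[OF jn] j by simp
          show False
          proof (cases "Y k = Y V")
            case True
            then show False using no'[of j] jB Yj j kx rj by simp
          next
            case neq: False
            have "{i. i < B \<and> Y i < Y j} \<subset> {i. i < B \<and> Y i < Y k}"
              using Yj jB by auto
            then have "card {i. i < B \<and> Y i < Y j} < card {i. i < B \<and> Y i < Y k}"
              by (intro psubset_card_mono) auto
            from less.hyps[OF this jB] show False
              using j kx rj neq False Yj k by auto
          qed
        qed
      qed
    qed
    have "overhangs V x y"
      unfolding overhangs_def
      using Vn V rS gap slide lineB by auto
    then show ?thesis using less.IH V by blast
  qed blast
qed

section \<open>Depth to which squares could have fallen\<close>

lemma last_support_of_overhangs: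
  assumes gen: "generic x y" and ov: "overhangs B x y"
  shows "last_support B < B" "last_support B < n" "top (last_support B) = Y B"
    "X B < right (last_support B)"
proof -
  have B: "B < n" "Y B \<noteq> 0" using gen ov by (auto simp: overhangs_def generic_def)
  show "last_support B < B" "last_support B < n" "top (last_support B) = Y B"
    "X B < right (last_support B)"
    using last_support(1)[OF B] B(1) by (auto simp: supports_def)
qed

text \<open>Square \<open>j\<close> could have followed \<open>B\<close>, slid to the right until
  \<open>x\<close> is covered, and dropped with its right side at \<open>x\<close>.\<close>

lemma placed_below_channel:
  assumes gen: "generic x y" and ov: "overhangs B x y"
    and j: "j \<le> B" "A j \<le> A B" "A j \<le> x - right (last_support B)"
    and z: "y < z" "z \<le> Y B"
    and free: "\<And>k. k < j \<Longrightarrow> X k < x \<Longrightarrow> x - A j < right k \<Longrightarrow> Y k < Y B \<Longrightarrow> z \<le> top k \<Longrightarrow> False"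
  shows "Y j < z"
proof -
  note S = last_support_of_overhangs[OF gen ov]
  have Bn: "B < n" using ov by (simp add: overhangs_def)
  \<comment> \<open>The drop ends at the larger of \<open>y\<close> and the highest top below
    \<open>z\<close>: then only squares reaching \<open>z\<close> can be in the way, and the final
    height is strictly below \<open>z\<close>.\<close>
  define E where "E = insert y (top ` {k. k < B \<and> top k < z})"
  define u where "u = Max E"
  have E: "finite E" "E \<noteq> {}" by (auto simp: E_def)
  have "u \<in> E" unfolding u_def by (rule Max_in[OF E])
  then have uz: "u < z" using z by (auto simp: E_def)
  have u_ge: "e \<le> u" if "e \<in> E" for e unfolding u_def using E(1) that by (rule Max_ge)
  have yu: "y \<le> u" by (rule u_ge) (simp add: E_def)
  have top_u: "z \<le> top k" if "k < B" "u < top k" for k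
    using u_ge[of "top k"] that by (force simp: E_def)
  \<comment> \<open>\<open>B\<close> stays if it already extends to \<open>x\<close>; otherwise it
    slides until its right side is at \<open>x\<close>.\<close>
  define \<xi> where "\<xi> = (if x \<le> right B then X B else x - A B)"
  have \<xi>: "X B \<le> \<xi>" "x \<le> \<xi> + A B" "\<xi> + A B \<le> 1" "\<xi> \<le> x - A j"
  proof (atomize (full), cases "x \<le> right B")
    case True
    then show "(X B \<le> \<xi> \<and> x \<le> \<xi> + A B) \<and> \<xi> + A B \<le> 1 \<and> \<xi> \<le> x - A j"
      using in_strip[OF Bn] S(4) j by (simp add: \<xi>_def right_def)
  next
    case False
    moreover have "x < 1" using gen by (simp add: generic_def)
    ultimately show "(X B \<le> \<xi> \<and> x \<le> \<xi> + A B) \<and> \<xi> + A B \<le> 1 \<and> \<xi> \<le> x - A j"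
      using j by (simp add: \<xi>_def right_def)
  qed
  have "Y j \<le> u"
  proof (rule slide_and_drop[OF j(1) Bn j(2) \<xi>(1) \<xi>(3) _ \<xi>(4)])
    fix k assume k: "k < B"
    show "\<not> (X k < \<xi> + A B \<and> X B < X k + A k \<and> Y k < Y B + A B \<and> Y B < Y k + A k)"
    proof
      assume h: "X k < \<xi> + A B \<and> X B < X k + A k \<and> Y k < Y B + A B \<and> Y B < Y k + A k"
      have kn: "k < n" using k Bn by simp
      have far: "right B \<le> X k"
      proof (rule ccontr)
        assume "\<not> right B \<le> X k"
        then have "k = B" using h by (intro overlap_eq[OF kn Bn]) (auto simp: right_def top_def)
        then show False using k by simp
      qed
      then have "\<not> x \<le> right B" using h by (auto simp: \<xi>_def right_def split: if_splits)
      then have "X k < x" using h by (simp add: \<xi>_def)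
      moreover have "right B < right k" using far right_gt[OF kn] by simp
      ultimately show False using ov k h by (auto simp: overhangs_def top_def)
    qed
  next
    fix k assume k: "k < j"
    show "\<not> (X k < x - A j + A j \<and> x - A j < X k + A k \<and> Y k < Y B \<and> u < Y k + A k)"
      using free[OF k] top_u[of k] k j(1) by (auto simp: top_def right_def)
  qed (use \<xi> yu uz z gen in \<open>auto simp: generic_def\<close>)
  then show ?thesis using uz by simp
qed

text \<open>Otherwise \<open>B\<close> itself would have fallen into the gap beside its last
  support.\<close>

lemma overhangs_width:
  assumes gen: "generic x y" and ov: "overhangs B x y"
  shows "x - right (last_support B) < A B"
proof (rule ccontr)
  assume c: "\<not> x - right (last_support B) < A B"
  have "Y B < Y B"
  proof (rule placed_below_channel[OF gen ov])
    fix k assume "k < B" "X k < x" "x - A B < right k" "Y k < Y B" "Y B \<le> top k"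
    then show False using ov c by (fastforce simp: overhangs_def)
  qed (use c ov in \<open>auto simp: overhangs_def\<close>)
  then show False by simp
qed

text \<open>If \<open>U\<close> fitted between \<open>k\<close> and \<open>x\<close>, it would have
  fallen below its actual position.\<close>

lemma channel_width:
  assumes gen: "generic x y" and st: "settled B x y"
    and U: "U < B" "y < Y U" "Y U \<le> Y B"
    and k: "k < B" "right (last_support B) \<le> right k" "right k < x"
    and max: "\<And>j. j < B \<Longrightarrow> Y j < Y U \<Longrightarrow> Y U \<le> top j \<Longrightarrow> right j < x \<Longrightarrow> right j \<le> right k"
  shows "x - right k < A U"
proof (rule ccontr)
  assume c: "\<not> x - right k < A U"
  have ov: "overhangs B x y" using st by (simp add: settled_def)
  have Bn: "B < n" using ov by (simp add: overhangs_def)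
  \<comment> \<open>Squares that would narrow the channel between the levels of \<open>U\<close> and
    \<open>B\<close>. As \<open>B\<close> is settled, the lowest has a square under it reaching at
    least as far right, which is again in \<open>Z\<close> or contradicts
    \<open>max\<close>.\<close>
  define Z where "Z = {i. i < B \<and> Y U \<le> Y i \<and> Y i < Y B \<and> right k < right i \<and> right i < x}"
  have Z_empty: "Z = {}"
  proof (rule ccontr)
    assume "Z \<noteq> {}"
    moreover have "finite Z" by (simp add: Z_def)
    ultimately obtain i where i: "i \<in> Z" "\<And>w. w \<in> Z \<Longrightarrow> Y i \<le> Y w"
      using ex_min_real[of Z _ Y] by blast
    then have iZ: "i < B" "Y U \<le> Y i" "Y i < Y B" "right k < right i" "right i < x"
      by (auto simp: Z_def)
    then have "y < Y i" "right (last_support B) \<le> right i" using U k by auto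
    with st iZ obtain q where q: "q < B" "Y q < Y i" "Y i \<le> top q" "right i \<le> right q" "right q < x"
      unfolding settled_def by blast
    show False
    proof (cases "Y q < Y U")
      case True
      then show False using max[of q] q i(1) by (auto simp: Z_def)
    next
      case False
      then have "q \<in> Z" using q i(1) by (auto simp: Z_def)
      then show False using i(2) q by fastforce
    qed
  qed
  have "Y U < Y U"
  proof (rule placed_below_channel[OF gen ov])
    fix i assume i: "i < U" "X i < x" "x - A U < right i" "Y i < Y B" "Y U \<le> top i"
    have iB: "i < B" and iN: "i < n" using i U Bn by auto
    have "\<not> x < right i"
    proof
      assume "x < right i"
      then have "top i \<le> y" using ov i iB unfolding overhangs_def by blast
      then show False using i U by simp
    qed
    then have ix: "right i < x" using gen iN by (auto simp: generic_def not_less order.order_iff_strict)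
    show False
    proof (cases "Y i < Y U")
      case True
      then show False using max[OF iB] i ix c by simp
    next
      case False
      then have "i \<in> Z" using i iB ix c by (auto simp: Z_def)
      then show False using Z_empty by simp
    qed
  next
    show "A U \<le> A B" using overhangs_width[OF gen ov] c k by simp
  qed (use U k c in auto)
  then show False by simp
qed

section \<open>Area of the channels\<close>

text \<open>Excluded are the points in the translate of a square to the right by its own side
  length; the translates cost one total area.\<close>

definition uncharged :: "real \<Rightarrow> real \<Rightarrow> bool" where
  "uncharged x y \<longleftrightarrow> (\<forall>k<n. \<not> (Y k \<le> y \<and> y \<le> top k \<and> right k \<le> x \<and> x \<le> right k + A k))"

text \<open>Below the bottom of \<open>U\<close> the channel to the right of \<open>U\<close> splits into disjoint channels that
  are narrower than \<open>U\<close>, for otherwise \<open>U\<close> would have been placed deeper.\<close>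

lemma cov_channel:
  assumes "B < n" "U < B" "z \<le> Y B" "Y U < z" "z \<le> top U" "right (last_support B) \<le> right U" "0 \<le> w"
    and "\<And>x y. (x, y) \<in> G \<Longrightarrow> generic x y \<and> settled B x y \<and> uncharged x y \<and> y < z \<and>
      right U < x \<and> x \<le> right U + w"
  shows "cov G (w\<^sup>2 / 2)"
  using assms(2-)
proof (induction "card {i. i < B \<and> Y i < Y U}" arbitrary: U z w G rule: less_induct)
  case less
  note U = less.prems(1-5) and w = less.prems(6) and G = less.prems(7)
  have Un: "U < n" using U assms(1) by simp
  \<comment> \<open>Beside \<open>U\<close>, points within distance \<open>A U\<close> are charged
    to \<open>U\<close>; what remains has width at most \<open>w - u\<close> and height at most
    \<open>u\<close>.\<close>
  define u where "u = min (A U) w"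
  have u: "0 \<le> u" "u \<le> w" using w side_pos[OF Un] by (auto simp: u_def)
  define K where "K = {k. k < B \<and> Y k < Y U \<and> Y U \<le> top k \<and> right U \<le> right k}"
  \<comment> \<open>Points whose nearest square to the left, just below the bottom level of
    \<open>U\<close>, is \<open>k\<close>; the supremum \<open>a k\<close> is the width they take
    up.\<close>
  define H where "H k = {p \<in> G. snd p < Y U \<and> right k < fst p \<and>
    (\<forall>j<B. Y j < Y U \<longrightarrow> Y U \<le> top j \<longrightarrow> right j < fst p \<longrightarrow> right j \<le> right k)}" for k
  define K' where "K' = {k \<in> K. H k \<noteq> {}}"
  define a where "a k = Sup ((\<lambda>p. fst p - right k) ` H k)" for k
  have fin: "finite K'" by (simp add: K'_def K_def)
  have H_le: "fst p \<le> right U + w" "fst p - right k < A U" if "k \<in> K" "p \<in> H k" for p k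
  proof -
    obtain x y where p: "p = (x, y)" by (cases p)
    have xy: "(x, y) \<in> G" using that p by (simp add: H_def)
    show "fst p \<le> right U + w" using G[OF xy] p by simp
    have "x - right k < A U"
      by (rule channel_width[of x y B U k]) (use G[OF xy] that p U in \<open>auto simp: H_def K_def\<close>)
    then show "fst p - right k < A U" using p by simp
  qed
  have le_a: "fst p - right k \<le> a k" if "k \<in> K" "p \<in> H k" for p k
    unfolding a_def
  proof (rule cSup_upper)
    show "bdd_above ((\<lambda>p. fst p - right k) ` H k)"
      using H_le(2)[OF that(1)] by (intro bdd_aboveI2[of _ _ "A U"]) force
  qed (use that in auto)
  have a_le: "a k \<le> c" if "k \<in> K'" "\<And>p. p \<in> H k \<Longrightarrow> fst p - right k \<le> c" for k c
    unfolding a_def using that by (intro cSup_least) (auto simp: K'_def)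
  have a_nn: "0 \<le> a k" if k: "k \<in> K'" for k
  proof -
    obtain p where "p \<in> H k" using k by (auto simp: K'_def)
    then show ?thesis using le_a[of k p] k by (auto simp: K'_def H_def)
  qed
  have a_w: "right k + a k \<le> right U + w" if k: "k \<in> K'" for k
    using a_le[OF k, of "right U + w - right k"] H_le(1)[of k] k by (force simp: K'_def)
  have a_u: "a k \<le> u" if k: "k \<in> K'" for k
    using a_le[OF k, of "A U"] a_w[OF k] H_le(2)[of k] k by (force simp: K'_def K_def u_def)
  \<comment> \<open>A point of \<open>H j\<close> beyond \<open>right k\<close> would have a nearer
    square than \<open>j\<close>.\<close>
  have sep: "right j + a j \<le> right k" if jk: "j \<in> K'" "k \<in> K'" "right j < right k" for j k
  proof -
    have "fst p - right j \<le> right k - right j" if p: "p \<in> H j" for p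
    proof -
      obtain x y where xy: "p = (x, y)" by (cases p)
      have "\<not> right k < x" using p jk xy by (auto simp: H_def K'_def K_def)
      then show ?thesis using xy by simp
    qed
    then show ?thesis using a_le[OF jk(1), of "right k - right j"] by simp
  qed
  have ne: "right j \<noteq> right k" if jk: "j \<in> K'" "k \<in> K'" "j \<noteq> k" for j k
  proof
    assume "right j = right k"
    then have "j = k"
      using jk right_gt[of j] right_gt[of k] assms(1)
      by (intro overlap_eq) (auto simp: K'_def K_def)
    then show False using jk by simp
  qed
  have sum_a: "(\<Sum>k\<in>K'. a k) \<le> w"
  proof (rule sum_disjoint_intervals_le[where l = right and c = "right U"])
    show "right j + a j \<le> right k \<or> right k + a k \<le> right j"
      if "j \<in> K'" "k \<in> K'" "j \<noteq> k" for j k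
      using ne[OF that] sep[of j k] sep[of k j] that by linarith
  qed (use fin a_nn a_w w in \<open>auto simp: K'_def K_def\<close>)
  have cov_H: "cov (H k) ((a k)\<^sup>2 / 2)" if k: "k \<in> K'" for k
  proof (rule less.hyps)
    have kK: "k \<in> K" using k by (simp add: K'_def)
    then have kB: "k < B" "Y k < Y U" "Y U \<le> top k" "right U \<le> right k" by (auto simp: K_def)
    have "{i. i < B \<and> Y i < Y k} \<subset> {i. i < B \<and> Y i < Y U}" using kB by auto
    then show "card {i. i < B \<and> Y i < Y k} < card {i. i < B \<and> Y i < Y U}"
      by (intro psubset_card_mono) auto
    show "k < B" "Y U \<le> Y B" "Y k < Y U" "Y U \<le> top k" "right (last_support B) \<le> right k"
      using kB U by auto
    show "0 \<le> a k" using a_nn k by simp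
    fix x y assume xy: "(x, y) \<in> H k"
    then have "(x, y) \<in> G" by (simp add: H_def)
    then show "generic x y \<and> settled B x y \<and> uncharged x y \<and> y < Y U \<and> right k < x \<and> x \<le> right k + a k"
      using G[of x y] xy le_a[OF kK xy] by (auto simp: H_def)
  qed
  have "G \<subseteq> {right U + u..right U + w} \<times> {Y U..Y U + u} \<union> (\<Union>k\<in>K'. H k)"
  proof
    fix p assume p: "p \<in> G"
    obtain x y where xy: "p = (x, y)" by (cases p)
    note g = G[OF p[unfolded xy]]
    have "y \<noteq> Y U" using g Un by (auto simp: generic_def)
    then consider "Y U < y" | "y < Y U" by linarith
    then show "p \<in> {right U + u..right U + w} \<times> {Y U..Y U + u} \<union> (\<Union>k\<in>K'. H k)"
    proof cases
      case 1
      have "right U + A U < x"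
        using g 1 U Un unfolding uncharged_def by force
      then show ?thesis using g 1 U xy by (auto simp: u_def top_def min_def)
    next
      case 2
      define C where "C = {k. k < B \<and> Y k < Y U \<and> Y U \<le> top k \<and> right U \<le> right k \<and> right k < x}"
      have "finite C" by (simp add: C_def)
      \<comment> \<open>Settledness applied to \<open>U\<close> itself.\<close>
      moreover have "C \<noteq> {}" using g 2 U by (auto simp: settled_def C_def)
      ultimately obtain k where k: "k \<in> C" "\<And>j. j \<in> C \<Longrightarrow> - right k \<le> - right j"
        using ex_min_real[of C _ "\<lambda>k. - right k"] by blast
      have "right j \<le> right k" if "j < B" "Y j < Y U" "Y U \<le> top j" "right j < x" for j
        using k that by (cases "right U \<le> right j") (auto simp: C_def)
      then have "p \<in> H k" using p xy 2 k(1) by (auto simp: H_def C_def)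
      then have "k \<in> K'" using k(1) by (auto simp: K'_def K_def C_def)
      with \<open>p \<in> H k\<close> show ?thesis by blast
    qed
  qed
  moreover have "cov ({right U + u..right U + w} \<times> {Y U..Y U + u} \<union> (\<Union>k\<in>K'. H k))
      ((w - u) * u + (\<Sum>k\<in>K'. (a k)\<^sup>2 / 2))"
  proof (intro cov_Un cov_UN)
    show "cov ({right U + u..right U + w} \<times> {Y U..Y U + u}) ((w - u) * u)"
      using cov_rectangle[of "right U + u" "right U + w" "Y U" "Y U + u"] u by simp
  qed (use fin cov_H u in \<open>auto intro!: sum_nonneg\<close>)
  \<comment> \<open>Here \<open>u * (w - u) + (u\<^sup>2 + (w - u)\<^sup>2) / 2 = w\<^sup>2 /
    2\<close>.\<close>
  moreover have "(w - u) * u + (\<Sum>k\<in>K'. (a k)\<^sup>2 / 2) \<le> w\<^sup>2 / 2"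
    using sum_squares_le_of_bounded[OF fin a_nn a_u sum_a u]
    by (simp add: sum_divide_distrib[symmetric] power2_eq_square algebra_simps)
  ultimately show ?case using cov_mono by blast
qed

text \<open>The outermost channel starts at the last support of \<open>B\<close>, whose top is level
  with the bottom of \<open>B\<close>; \<open>overhangs_width\<close> caps its width at
  \<open>A B\<close>.\<close>

lemma cov_settled:
  assumes "B < n"
  shows "cov {(x, y). generic x y \<and> settled B x y \<and> uncharged x y} ((A B)\<^sup>2 / 2)"
    (is "cov ?G _")
proof (cases "?G = {}")
  case True
  have "cov {} ((A B)\<^sup>2 / 2)" by (rule cov_mono[OF cov_empty]) simp_all
  then show ?thesis by (simp only: True)
next
  case False
  then obtain x y where "generic x y" "overhangs B x y" by (auto simp: settled_def)
  note S = last_support_of_overhangs[OF this]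
  show ?thesis
  proof (rule cov_channel[OF assms S(1) order_refl])
    show "generic x y \<and> settled B x y \<and> uncharged x y \<and> y < Y B \<and>
        right (last_support B) < x \<and> x \<le> right (last_support B) + A B"
      if "(x, y) \<in> ?G" for x y
      using that overhangs_width[of x y B] by (auto simp: settled_def overhangs_def)
  qed (use S top_gt[OF S(2)] side_pos[OF assms] in auto)
qed

section \<open>Adding up the charges\<close>

text \<open>The trapezoid under the left overhang of \<open>T\<close>, down to the diagonal of
  \<open>above_staircase\<close>; \<open>Y T - A (last_support T)\<close> is the bottom of the last
  support.\<close>

definition staircase :: "nat \<Rightarrow> (real \<times> real) set" where
  "staircase T = (if Y T \<noteq> 0 \<and> X T < X (last_support T)
     then {(x, y). X T \<le> x \<and> x \<le> X (last_support T) \<and>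
       Y T - A (last_support T) - (X (last_support T) - x) \<le> y \<and> y \<le> Y T} else {})"

text \<open>The share passed on to the last support, beyond the area of \<open>T\<close>
  itself.\<close>

definition left_charge :: "nat \<Rightarrow> real" where
  "left_charge T = (if Y T \<noteq> 0 \<and> X T < X (last_support T) then (A (last_support T))\<^sup>2 / 2 else 0)"

lemma cov_below:
  assumes T: "T < n"
  shows "cov (staircase T \<union> {(x, y). generic x y \<and> settled T x y \<and> uncharged x y})
    ((A T)\<^sup>2 + left_charge T)"
proof (cases "Y T \<noteq> 0 \<and> X T < X (last_support T)")
  case False
  then have st: "cov (staircase T) 0" and lc: "left_charge T = 0"
    by (auto simp: staircase_def left_charge_def cov_empty)
  show ?thesis
    by (rule cov_mono[OF cov_Un[OF st cov_settled[OF T]]]) (simp_all add: lc)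
next
  case True
  let ?S = "last_support T"
  define s w where "s = A ?S" and "w = X ?S - X T"
  have S: "?S < n" "X ?S < right T"
    using last_support(1)[OF T] True T by (auto simp: supports_def)
  have sw: "0 \<le> s" "0 \<le> w" "w \<le> A T"
    using side_pos[OF S(1)] True S by (auto simp: s_def w_def right_def)
  have st: "cov (staircase T) (s * w + w\<^sup>2 / 2)"
    using cov_trapezoid[OF sw(1,2), of "X T" "Y T"] True
    by (auto simp: staircase_def s_def w_def)
  have lc: "left_charge T = s\<^sup>2 / 2" using True by (simp add: left_charge_def s_def)
  show ?thesis
  proof (cases "right ?S < right T")
    case True
    \<comment> \<open>With a right overhang, \<open>T\<close> spans its left overhang and the whole
      top of its last support.\<close>
    have "s + w \<le> A T" using True by (simp add: right_def s_def w_def)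
    then have "(s + w)\<^sup>2 \<le> (A T)\<^sup>2" using sw by (intro power_mono) auto
    then have "s\<^sup>2 + w\<^sup>2 + 2 * (s * w) \<le> (A T)\<^sup>2" by (simp add: power2_sum mult.assoc)
    then have "s * w + w\<^sup>2 / 2 + (A T)\<^sup>2 / 2 \<le> (A T)\<^sup>2 + s\<^sup>2 / 2"
      using zero_le_power2[of s] by linarith
    then show ?thesis
      unfolding lc using sw by (intro cov_mono[OF cov_Un[OF st cov_settled[OF T]] order_refl]) simp_all
  next
    \<comment> \<open>Without a right overhang no point is settled at \<open>T\<close>, and
      \<open>2 * s * w \<le> s\<^sup>2 + w\<^sup>2\<close> splits the trapezoid between
      \<open>T\<close> and its support.\<close>
    case False
    then have empty: "{(x, y). generic x y \<and> settled T x y \<and> uncharged x y} = {}"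
      by (auto simp: settled_def overhangs_def)
    have "w\<^sup>2 \<le> (A T)\<^sup>2" using sw by (intro power_mono) auto
    moreover have "2 * (s * w) \<le> s\<^sup>2 + w\<^sup>2"
      using sum_squares_bound[of s w] by simp
    ultimately have "s * w + w\<^sup>2 / 2 \<le> (A T)\<^sup>2 + s\<^sup>2 / 2" by simp
    then show ?thesis unfolding lc empty by (intro cov_mono[OF st]) simp_all
  qed
qed

text \<open>Each square is charged at most once: every \<open>T\<close> charging it covers the
  points just above its upper left corner.\<close>

lemma sum_left_charge: "(\<Sum>T<n. left_charge T) \<le> (\<Sum>k<n. (A k)\<^sup>2) / 2"
proof -
  define J where "J = {T. T < n \<and> Y T \<noteq> 0 \<and> X T < X (last_support T)}"
  have J: "last_support T < n \<and> top (last_support T) = Y T \<and> X (last_support T) < right T" if "T \<in> J" for T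
    using last_support(1)[of T] that by (auto simp: J_def supports_def)
  have inj: "inj_on last_support J"
  proof (rule inj_onI)
    fix T T' assume "T \<in> J" "T' \<in> J" "last_support T = last_support T'"
    then show "T = T'"
      using J[of T] J[of T'] top_gt[of T] top_gt[of T']
      by (intro overlap_eq) (auto simp: J_def)
  qed
  have "(\<Sum>T<n. left_charge T) = (\<Sum>T\<in>J. (A (last_support T))\<^sup>2 / 2)"
    by (rule sum.mono_neutral_cong_right) (auto simp: J_def left_charge_def)
  also have "\<dots> = (\<Sum>k\<in>last_support ` J. (A k)\<^sup>2 / 2)"
    using inj by (simp add: sum.reindex)
  also have "\<dots> \<le> (\<Sum>k<n. (A k)\<^sup>2 / 2)"
    using J by (intro sum_mono2) auto
  finally show ?thesis by (simp add: sum_divide_distrib)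
qed

lemma cov_not_generic:
  "cov {(x, y). 0 \<le> x \<and> x \<le> 1 \<and> 0 \<le> y \<and> \<not> generic x y} 0"
proof -
  have line: "cov (V \<union> W) 0" if "cov V 0" "cov W 0" for V W
    using cov_Un[OF that] by simp
  have "cov (\<Union>k<n. {X k} \<times> UNIV \<union> {right k} \<times> UNIV \<union> UNIV \<times> {Y k} \<union> UNIV \<times> {top k}) (\<Sum>k<n. 0)"
    by (intro cov_UN line cov_vertical_line cov_horizontal_line) auto
  then have "cov ((\<Union>k<n. {X k} \<times> UNIV \<union> {right k} \<times> UNIV \<union> UNIV \<times> {Y k} \<union> UNIV \<times> {top k}) \<union>
      ({0} \<times> UNIV \<union> {1} \<times> UNIV \<union> UNIV \<times> {0})) 0"
    by (intro line cov_vertical_line cov_horizontal_line) auto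
  then show ?thesis
    by (rule cov_mono) (auto simp: generic_def)
qed

text \<open>The lid \<open>m\<close> spans the strip, so there is a first square \<open>T\<close>
  above the point; the left side of its last support separates the two kinds of charges.\<close>

lemma free_point_charged:
  assumes gen: "generic x y" and m: "m < n" "X m = 0" "A m = 1" "y < Y m"
    and free: "\<And>k. k < n \<Longrightarrow> X k < x \<Longrightarrow> x < right k \<Longrightarrow> Y k < y \<Longrightarrow> top k < y"
  shows "\<exists>T<n. (x, y) \<in> staircase T \<or> settled T x y"
proof -
  define C where "C = {k. k < n \<and> X k < x \<and> x < right k \<and> y < Y k}"
  have "m \<in> C" using m gen by (auto simp: C_def generic_def right_def)
  moreover have "finite C" by (simp add: C_def)
  ultimately obtain T where T: "T \<in> C" "\<And>k. k \<in> C \<Longrightarrow> Y T \<le> Y k"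
    using ex_min_real[of C m Y] by blast
  have Tn: "T < n" and xT: "X T < x" "x < right T" and yT: "y < Y T" using T by (auto simp: C_def)
  have Y: "Y T \<noteq> 0" using yT gen by (auto simp: generic_def)
  have S: "last_support T < n" "top (last_support T) = Y T"
    using last_support(1)[OF Tn Y] Tn by (auto simp: supports_def)
  have line: "top k \<le> y" if k: "k < n" "X k < x" "x < right k" "Y k < Y T" for k
  proof (rule ccontr)
    assume "\<not> top k \<le> y"
    then have "\<not> Y k < y" using free k by fastforce
    then have "k \<in> C" using k gen by (auto simp: C_def generic_def order.order_iff_strict)
    then show False using T(2) k by fastforce
  qed
  have "x \<noteq> X (last_support T)" using gen S by (auto simp: generic_def)
  then consider "x < X (last_support T)" | "X (last_support T) < x" by linarith
  then show ?thesis
  proof cases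
    case 1
    have "Y (last_support T) - (X (last_support T) - x) \<le> y"
      by (rule above_staircase[OF Tn Y gen xT(1) 1 line])
    then have "(x, y) \<in> staircase T"
      using 1 xT yT Y S by (auto simp: staircase_def top_def)
    then show ?thesis using Tn by blast
  next
    case 2
    have "overhangs T x y" by (rule overhangs_lid[OF Tn gen yT 2 xT(2) line])
    then obtain B where "settled B x y" using overhangs_imp_settled[OF gen] by blast
    then show ?thesis by (auto simp: settled_def overhangs_def)
  qed
qed

text \<open>The squares before the lid give the first sum. Translates and \<open>cov_below\<close>
  give one full sum each and the left charges half a sum, hence \<open>5 / 2\<close>.\<close>

theorem lid_height_le:
  assumes n: "n = Suc m" and m: "X m = 0" "A m = 1"
  shows "Y m \<le> (\<Sum>k<m. (A k)\<^sup>2) + 5 / 2 * (\<Sum>k<n. (A k)\<^sup>2)"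
proof -
  define N where "N = {(x, y). 0 \<le> x \<and> x \<le> 1 \<and> 0 \<le> y \<and> \<not> generic x y}"
  define Q where "Q k = {X k..X k + A k} \<times> {Y k..Y k + A k}" for k
  define R where "R k = {right k..right k + A k} \<times> {Y k..Y k + A k}" for k
  define W where "W T = staircase T \<union> {(x, y). generic x y \<and> settled T x y \<and> uncharged x y}" for T
  have mn: "m < n" using n by simp
  have "{0..1} \<times> {0..Y m} \<subseteq> N \<union> (\<Union>k<m. Q k) \<union> (\<Union>k<n. R k) \<union> (\<Union>T<n. W T)"
  proof
    fix p :: "real \<times> real" assume "p \<in> {0..1} \<times> {0..Y m}"
    then obtain x y where p: "p = (x, y)" and xy: "0 \<le> x" "x \<le> 1" "0 \<le> y" "y \<le> Y m" by auto
    show "p \<in> N \<union> (\<Union>k<m. Q k) \<union> (\<Union>k<n. R k) \<union> (\<Union>T<n. W T)"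
    proof (rule ccontr)
      assume c: "p \<notin> N \<union> (\<Union>k<m. Q k) \<union> (\<Union>k<n. R k) \<union> (\<Union>T<n. W T)"
      have gen: "generic x y" using c p xy by (auto simp: N_def)
      have ym: "y < Y m" using gen xy mn by (auto simp: generic_def order.order_iff_strict)
      have un: "uncharged x y" using c p by (auto simp: uncharged_def R_def top_def)
      have "\<exists>T<n. (x, y) \<in> staircase T \<or> settled T x y"
      proof (rule free_point_charged[OF gen mn m ym])
        fix k assume k: "k < n" "X k < x" "x < right k" "Y k < y"
        then have "k \<noteq> m" using ym by auto
        then have "k < m" using k n by simp
        then have "p \<notin> Q k" using c by blast
        then show "top k < y" using k p by (auto simp: Q_def right_def top_def)
      qed
      then show False using c p gen un by (auto simp: W_def)
    qed
  qed
  moreover have "cov (N \<union> (\<Union>k<m. Q k) \<union> (\<Union>k<n. R k) \<union> (\<Union>T<n. W T))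
      (0 + (\<Sum>k<m. (A k)\<^sup>2) + (\<Sum>k<n. (A k)\<^sup>2) + (\<Sum>T<n. (A T)\<^sup>2 + left_charge T))"
  proof (intro cov_Un cov_UN)
    show "cov N 0" unfolding N_def by (rule cov_not_generic)
    show "cov (Q k) ((A k)\<^sup>2)" if "k \<in> {..<m}" for k
      using cov_rectangle[of "X k" "X k + A k" "Y k" "Y k + A k"] side_pos[of k] that n
      by (simp add: Q_def power2_eq_square)
    show "cov (R k) ((A k)\<^sup>2)" if "k \<in> {..<n}" for k
      using cov_rectangle[of "right k" "right k + A k" "Y k" "Y k + A k"] side_pos[of k] that
      by (simp add: R_def power2_eq_square)
    show "cov (W T) ((A T)\<^sup>2 + left_charge T)" if "T \<in> {..<n}" for T
      unfolding W_def using that by (intro cov_below) simp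
  qed (auto intro!: sum_nonneg add_nonneg_nonneg simp: left_charge_def)
  ultimately have "cov ({0..1} \<times> {0..Y m})
      (0 + (\<Sum>k<m. (A k)\<^sup>2) + (\<Sum>k<n. (A k)\<^sup>2) + (\<Sum>T<n. (A T)\<^sup>2 + left_charge T))"
    using cov_mono by blast
  then have "Y m \<le> 0 + (\<Sum>k<m. (A k)\<^sup>2) + (\<Sum>k<n. (A k)\<^sup>2) + (\<Sum>T<n. (A T)\<^sup>2 + left_charge T)"
    by (rule cov_rectangle_le)
      (use in_strip[OF mn] in \<open>auto intro!: sum_nonneg add_nonneg_nonneg simp: left_charge_def\<close>)
  then show ?thesis using sum_left_charge by (simp add: sum.distrib)
qed

end

section \<open>The packing produced by BottomLeft\<close>

lemma height_mono: "set P' \<subseteq> set P \<Longrightarrow> height P' \<le> height P"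
  unfolding height_def by (intro Max_mono insert_mono image_mono) auto

lemma free_subsquare:
  assumes "free P a (x, y)" "set P' \<subseteq> set P" "0 < b" "0 \<le> d" "d + b \<le> a"
  shows "free P' b (x + d, y)"
  using assms by (fastforce simp: free_iff)

text \<open>The smaller square travels inside the larger one at horizontal offset \<open>d\<close>,
  among fewer obstacles.\<close>

lemma reachable_subsquare:
  assumes p: "(x, y) \<in> reachable P a" and P': "set P' \<subseteq> set P"
    and b: "0 < b" "0 \<le> d" "d + b \<le> a"
  shows "(x + d, y) \<in> reachable P' b"
proof -
  obtain g where g: "path g" "height P \<le> snd (pathstart g)" "pathfinish g = (x, y)"
    "\<forall>q\<in>path_image g. free P a q" "antimono_on {0..1} (\<lambda>t. snd (g t))"
    using p unfolding reachable_def by blast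
  let ?h = "\<lambda>t. g t + (d, 0)"
  have "path ?h" using g(1) unfolding path_def by (intro continuous_intros)
  moreover have "height P' \<le> snd (pathstart ?h)"
    using height_mono[OF P'] g(2) by (simp add: pathstart_def)
  moreover have "pathfinish ?h = (x + d, y)" using g(3) by (simp add: pathfinish_def)
  moreover have "free P' b q" if q: "q \<in> path_image ?h" for q
  proof -
    obtain t where t: "t \<in> {0..1}" "q = g t + (d, 0)" using q by (auto simp: path_image_def)
    then have "free P a (fst (g t), snd (g t))" using g(4) by (simp add: path_image_def)
    then have "free P' b (fst (g t) + d, snd (g t))" by (rule free_subsquare[OF _ P' b])
    then show ?thesis using t by (simp add: plus_prod_def)
  qed
  moreover have "antimono_on {0..1} (\<lambda>t. snd (?h t))" using g(5) by simp
  ultimately show ?thesis unfolding reachable_def by blast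
qed

section \<open>Runs and their prefixes\<close>

lemma run_snoc: "run S (as @ [a]) = run S as @ [(S (run S as) a, a)]"
  by (simp add: run_def)

lemma map_snd_run: "map snd (run S as) = as"
  by (induction as rule: rev_induct) (simp_all add: run_snoc, simp add: run_def)

lemma length_run: "length (run S as) = length as"
  using map_snd_run[of S as] by (metis length_map)

lemma take_run: "take i (run S as) = run S (take i as)"
proof (induction as rule: rev_induct)
  case Nil
  then show ?case by (simp add: run_def)
next
  case (snoc a as)
  then show ?case
    by (cases "i \<le> length as") (simp_all add: run_snoc length_run)
qed

lemma run_nth:
  assumes "i < length as"
  shows "run S as ! i = (S (run S (take i as)) (as ! i), as ! i)"
proof -
  have "run S as ! i = run S (take (Suc i) as) ! i"
    by (simp flip: take_run)
  also have "\<dots> = (S (run S (take i as)) (as ! i), as ! i)"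
    using assms by (simp add: take_Suc_conv_app_nth run_snoc nth_append length_run)
  finally show ?thesis .
qed

section \<open>Area as a lower bound for the height of a packing\<close>

lemma sum_squares_le_height:
  assumes P: "packing as P" and valid: "valid_input as"
  shows "(\<Sum>k<length as. (as ! k)\<^sup>2) \<le> height P"
proof -
  let ?I = "\<lambda>k. interior (square (P ! k))"
  have len: "length P = length as" and side: "\<And>k. k < length as \<Longrightarrow> snd (P ! k) = as ! k"
    using P unfolding packing_def by (metis length_map, metis length_map nth_map)
  have pos: "0 < as ! k" if "k < length as" for k
    using valid that by (simp add: valid_input_def)
  have em: "emeasure lborel (?I k) = ennreal ((as ! k)\<^sup>2)" if k: "k < length as" for k
  proof -
    obtain x y where xy: "P ! k = ((x, y), as ! k)" using side[OF k] by (metis prod.collapse)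
    have "?I k = {x<..<x + as ! k} \<times> {y<..<y + as ! k}"
      by (simp add: xy square_def interior_Times)
    moreover have "emeasure lborel ({x<..<x + as ! k} \<times> {y<..<y + as ! k}) =
        emeasure lborel {x<..<x + as ! k} * emeasure lborel {y<..<y + as ! k}"
      unfolding lborel_prod[symmetric] by (rule lborel.emeasure_pair_measure_Times) simp_all
    ultimately show ?thesis
      using pos[OF k] by (simp add: power2_eq_square ennreal_mult')
  qed
  have "ennreal (\<Sum>k<length as. (as ! k)\<^sup>2) = (\<Sum>k<length as. emeasure lborel (?I k))"
    by (simp add: em sum_ennreal)
  also have "\<dots> = emeasure lborel (\<Union>k<length as. ?I k)"
  proof (rule sum_emeasure)
    show "disjoint_family_on ?I {..<length as}"
    proof (unfold disjoint_family_on_def, intro ballI impI)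
      fix i j assume ij: "i \<in> {..<length as}" "j \<in> {..<length as}" "i \<noteq> j"
      have "non_overlapping (P ! i) (P ! j) \<or> non_overlapping (P ! j) (P ! i)"
        using P ij len unfolding packing_def sorted_wrt_iff_nth_less
        by (metis lessThan_iff linorder_neqE_nat)
      then show "?I i \<inter> ?I j = {}" unfolding non_overlapping_def by blast
    qed
  qed auto
  also have "\<dots> \<le> emeasure lborel ({0..1 :: real} \<times> {0..height P})"
  proof (rule emeasure_mono)
    show "(\<Union>k<length as. ?I k) \<subseteq> {0..1} \<times> {0..height P}"
    proof (rule UN_least)
      fix k assume "k \<in> {..<length as}"
      then have k: "k < length as" by simp
      obtain x y where xy: "P ! k = ((x, y), as ! k)" using side[OF k] by (metis prod.collapse)
      have mem: "((x, y), as ! k) \<in> set P" using k len xy by (metis nth_mem)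
      then have "square ((x, y), as ! k) \<subseteq> strip" using P by (simp add: packing_def)
      then have "0 \<le> x \<and> x + as ! k \<le> 1 \<and> 0 \<le> y"
        using square_subset_strip_iff[OF pos[OF k]] by simp
      then have "square (P ! k) \<subseteq> {0..1} \<times> {0..height P}"
        using top_le_height[OF mem] pos[OF k] by (auto simp: square_def xy)
      then show "?I k \<subseteq> {0..1} \<times> {0..height P}" using interior_subset by blast
    qed
  qed (simp add: borel_closed closed_Times)
  also have "\<dots> = ennreal (height P)"
    using emeasure_rectangle[of 0 1 0 "height P"] height_nonneg[of P] by simp
  finally show ?thesis using height_nonneg[of P] by simp
qed

section \<open>From BottomLeft to the abstract packing\<close>

context
  fixes as :: "real list" and X Y A :: "nat \<Rightarrow> real"
  assumes valid: "valid_input as"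
  defines "X i \<equiv> fst (fst (run bottom_left as ! i))"
    and "Y i \<equiv> snd (fst (run bottom_left as ! i))"
    and "A i \<equiv> as ! i"
begin

lemma run_nth_eq: "i < length as \<Longrightarrow> run bottom_left as ! i = ((X i, Y i), A i)"
  unfolding X_def Y_def A_def by (simp add: run_nth)

lemma side_range: "i < length as \<Longrightarrow> 0 < A i \<and> A i \<le> 1"
  using valid by (auto simp: A_def valid_input_def)

lemma is_bottom_left_run:
  assumes "i < length as"
  shows "is_bottom_left (take i (run bottom_left as)) (A i) (X i, Y i)"
proof -
  have "(X i, Y i) = bottom_left (take i (run bottom_left as)) (A i)"
    using run_nth[OF assms, of bottom_left] run_nth_eq[OF assms] by (simp add: take_run A_def)
  then show ?thesis
    using is_bottom_left_bottom_left side_range[OF assms] by simp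
qed

lemma in_set_take_run:
  assumes "i \<le> length as"
  shows "t \<in> set (take i (run bottom_left as)) \<longleftrightarrow> (\<exists>k<i. t = ((X k, Y k), A k))"
  using assms run_nth_eq by (auto simp: in_set_conv_nth length_run)

lemma free_take_run:
  assumes "i \<le> length as" "0 < a"
  shows "free (take i (run bottom_left as)) a (x, y) \<longleftrightarrow> 0 \<le> x \<and> x + a \<le> 1 \<and> 0 \<le> y \<and>
    (\<forall>k<i. x + a \<le> X k \<or> X k + A k \<le> x \<or> y + a \<le> Y k \<or> Y k + A k \<le> y)"
proof -
  have "\<not> A k \<le> 0" if "k < i" for k using side_range[of k] that assms by simp
  then show ?thesis
    unfolding free_iff[OF assms(2)] Ball_def in_set_take_run[OF assms(1)] by fastforce
qed

text \<open>The leftmost choice yields left neighbours, gravity yields supports, and the bottommost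
  choice yields \<open>slide_and_drop\<close>, since the alternative position is reachable for
  \<open>j\<close>.\<close>

lemma bottom_left_packing_run: "bottom_left_packing (length as) X Y A"
proof
  let ?P = "\<lambda>i. take i (run bottom_left as)"
  have reach: "(X i, Y i) \<in> reachable (?P i) (A i)" if "i < length as" for i
    using is_bottom_left_run[OF that] by (simp add: is_bottom_left_def)
  have free: "free (?P i) (A i) (X i, Y i)" if "i < length as" for i
    using reachable_free[OF reach[OF that]] .
  have lowest: "Y i \<le> y" if "i < length as" "(x, y) \<in> reachable (?P i) (A i)" for i x y
    using is_bottom_left_run[OF that(1)] that(2) by (force simp: is_bottom_left_def)
  show pos: "0 < A i" if "i < length as" for i using side_range[OF that] by simp
  show strip: "0 \<le> X i \<and> X i + A i \<le> 1 \<and> 0 \<le> Y i" if "i < length as" for i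
    using free[OF that] free_take_run[of i "A i"] pos[OF that] that by simp
  have before: "X i + A i \<le> X k \<or> X k + A k \<le> X i \<or> Y i + A i \<le> Y k \<or> Y k + A k \<le> Y i"
    if "i < length as" "k < i" for i k
    using free[OF that(1)] free_take_run[of i "A i"] pos[OF that(1)] that by simp
  show "X i + A i \<le> X j \<or> X j + A j \<le> X i \<or> Y i + A i \<le> Y j \<or> Y j + A j \<le> Y i"
    if "i < length as" "j < length as" "i \<noteq> j" for i j
    using before[of i j] before[of j i] that by (meson linorder_neqE_nat)
  show "\<exists>j<i. X j + A j = X i \<and> Y j < Y i + A i \<and> Y i < Y j + A j"
    if i: "i < length as" and X0: "X i \<noteq> 0" for i
  proof (rule ccontr)
    assume no: "\<not> ?thesis"
    \<comment> \<open>Without a touching neighbour the square could slide to the next right side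
      strictly left of it, or to the wall.\<close>
    define E where "E = insert 0 ((\<lambda>k. X k + A k) ` {k. k < i \<and> X k + A k < X i})"
    define u where "u = Max E"
    have E: "finite E" "E \<noteq> {}" by (auto simp: E_def)
    have "u \<in> E" unfolding u_def by (rule Max_in[OF E])
    then have u: "u < X i" using strip[OF i] X0 by (auto simp: E_def)
    have u_ge: "e \<le> u" if "e \<in> E" for e unfolding u_def using E(1) that by (rule Max_ge)
    have u0: "0 \<le> u" by (rule u_ge) (simp add: E_def)
    have "(u, Y i) \<in> reachable (?P i) (A i)"
    proof (rule reachable_extend[OF reach[OF i]])
      fix r assume "r \<in> closed_segment (X i, Y i) (u, Y i)"
      then obtain z where z: "r = (z, Y i)" "u \<le> z" "z \<le> X i"
        using closed_segment_horizontal u by (metis less_imp_le)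
      have "z + A i \<le> X k \<or> X k + A k \<le> z \<or> Y i + A i \<le> Y k \<or> Y k + A k \<le> Y i" if k: "k < i" for k
        using before[OF i k] no u_ge[of "X k + A k"] k z by (force simp: E_def)
      then show "free (?P i) (A i) r"
        using free_take_run[of i "A i" z "Y i"] i pos[OF i] strip[OF i] z u0 by simp
    qed simp
    then have "X i \<le> u"
      using is_bottom_left_run[OF i] by (force simp: is_bottom_left_def)
    then show False using u by simp
  qed
  show "\<exists>j<i. Y j + A j = Y i \<and> X j < X i + A i \<and> X i < X j + A j"
    if i: "i < length as" and Y0: "Y i \<noteq> 0" for i
  proof -
    have "supported (?P i) ((X i, Y i), A i)"
      by (rule is_bottom_left_supported[OF pos[OF i] is_bottom_left_run[OF i]])
    moreover have "\<not> bottom_side ((X i, Y i), A i) \<subseteq> strip_bottom"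
      using Y0 pos[OF i] by (simp add: bottom_side_def strip_bottom_def times_subset_iff)
    ultimately obtain t p q where t: "t \<in> set (?P i)" "p \<noteq> q"
      "bottom_side ((X i, Y i), A i) \<inter> top_side t = closed_segment p q"
      unfolding supported_def by blast
    obtain j where j: "j < i" "t = ((X j, Y j), A j)"
      using t(1) in_set_take_run[of i t] i by auto
    have "p \<in> closed_segment p q" "q \<in> closed_segment p q" by auto
    then have "p \<in> {X i..X i + A i} \<times> {Y i}" "p \<in> {X j..X j + A j} \<times> {Y j + A j}"
      "q \<in> {X i..X i + A i} \<times> {Y i}" "q \<in> {X j..X j + A j} \<times> {Y j + A j}"
      unfolding t(3)[symmetric] by (simp_all add: bottom_side_def top_side_def j)
    moreover from this have "fst p \<noteq> fst q" using t(2) by (auto simp: prod_eq_iff)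
    ultimately have "Y j + A j = Y i \<and> X j < X i + A i \<and> X i < X j + A j" by auto
    then show ?thesis using j by blast
  qed
  show "Y j \<le> y"
    if ji: "j \<le> i" and i: "i < length as" and Aji: "A j \<le> A i" and \<xi>: "X i \<le> \<xi>" "\<xi> + A i \<le> 1"
      and slide: "\<And>k. k < i \<Longrightarrow> \<not> (X k < \<xi> + A i \<and> X i < X k + A k \<and> Y k < Y i + A i \<and> Y i < Y k + A k)"
      and x: "\<xi> \<le> x" "x + A j \<le> \<xi> + A i" and y: "0 \<le> y" "y \<le> Y i"
      and drop: "\<And>k. k < j \<Longrightarrow> \<not> (X k < x + A j \<and> x < X k + A k \<and> Y k < Y i \<and> y < Y k + A k)"
    for i j \<xi> x y
  proof -
    have j: "j < length as" using ji i by simp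
    have "(\<xi>, Y i) \<in> reachable (?P i) (A i)"
    proof (rule reachable_extend[OF reach[OF i]])
      fix r assume "r \<in> closed_segment (X i, Y i) (\<xi>, Y i)"
      then have "r \<in> closed_segment (\<xi>, Y i) (X i, Y i)" by (simp add: closed_segment_commute)
      then obtain z where z: "r = (z, Y i)" "X i \<le> z" "z \<le> \<xi>"
        using closed_segment_horizontal \<xi>(1) by blast
      have "z + A i \<le> X k \<or> X k + A k \<le> z \<or> Y i + A i \<le> Y k \<or> Y k + A k \<le> Y i" if k: "k < i" for k
        using slide[OF k] z by linarith
      then show "free (?P i) (A i) r"
        using free_take_run[of i "A i" z "Y i"] i pos[OF i] strip[OF i] z \<xi> by simp
    qed simp
    \<comment> \<open>The path of \<open>i\<close> carries \<open>j\<close> along at offset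
      \<open>x - \<xi>\<close>, among the squares placed before \<open>j\<close>.\<close>
    then have "(\<xi> + (x - \<xi>), Y i) \<in> reachable (?P j) (A j)"
      by (rule reachable_subsquare) (use ji pos[OF j] x in \<open>auto simp: set_take_subset_set_take\<close>)
    then have rx: "(x, Y i) \<in> reachable (?P j) (A j)" by simp
    then have fx: "0 \<le> x" "x + A j \<le> 1" "\<And>k. k < j \<Longrightarrow>
        x + A j \<le> X k \<or> X k + A k \<le> x \<or> Y i + A j \<le> Y k \<or> Y k + A k \<le> Y i"
      using reachable_free[OF rx] free_take_run[of j "A j" x "Y i"] j pos[OF j] by auto
    have "(x, y) \<in> reachable (?P j) (A j)"
    proof (rule reachable_extend[OF rx])
      fix r assume "r \<in> closed_segment (x, Y i) (x, y)"
      then obtain z where z: "r = (x, z)" "y \<le> z" "z \<le> Y i"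
        using closed_segment_vertical y(2) by blast
      have "x + A j \<le> X k \<or> X k + A k \<le> x \<or> z + A j \<le> Y k \<or> Y k + A k \<le> z" if k: "k < j" for k
        using drop[OF k] fx(3)[OF k] z pos[of k] k j by fastforce
      then show "free (?P j) (A j) r"
        using free_take_run[of j "A j" x z] j pos[OF j] fx z y by simp
    qed (use y in simp)
    then show ?thesis by (rule lowest[OF j])
  qed
qed

lemma packing_run: "packing as (run bottom_left as)"
  unfolding packing_def
proof (intro conjI)
  show "map snd (run bottom_left as) = as" by (rule map_snd_run)
  have free: "free (take i (run bottom_left as)) (A i) (X i, Y i)" if "i < length as" for i
    using is_bottom_left_run[OF that] reachable_free by (auto simp: is_bottom_left_def)
  show "\<forall>s\<in>set (run bottom_left as). square s \<subseteq> strip"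
  proof
    fix s assume "s \<in> set (run bottom_left as)"
    then obtain i where "i < length as" "s = ((X i, Y i), A i)"
      using run_nth_eq by (auto simp: in_set_conv_nth length_run)
    then show "square s \<subseteq> strip" using free by (simp add: free_def)
  qed
  show "sorted_wrt non_overlapping (run bottom_left as)"
    unfolding sorted_wrt_iff_nth_less
  proof (intro allI impI)
    fix i j assume ij: "i < j" "j < length (run bottom_left as)"
    then have "j < length as" by (simp add: length_run)
    then have "((X i, Y i), A i) \<in> set (take j (run bottom_left as))"
      using in_set_take_run[of j "((X i, Y i), A i)"] ij by auto
    then have "non_overlapping ((X j, Y j), A j) ((X i, Y i), A i)"
      using free[OF \<open>j < length as\<close>] by (simp add: free_def)
    then show "non_overlapping (run bottom_left as ! i) (run bottom_left as ! j)"
      using run_nth_eq[of i] run_nth_eq[of j] ij \<open>j < length as\<close>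
      by (auto simp: non_overlapping_def)
  qed
qed

end

section \<open>The unit lid and the final bound\<close>

text \<open>A square as wide as the strip cannot pass a placed one. It starts above all of them and
  moves continuously, so it ends above all of them.\<close>

lemma height_le_lid:
  assumes valid: "valid_input as" and lid: "(x, y) \<in> reachable (run bottom_left as) 1"
  shows "x = 0" "height (run bottom_left as) \<le> y"
proof -
  let ?P = "run bottom_left as"
  obtain g where g: "path g" "height ?P \<le> snd (pathstart g)" "pathfinish g = (x, y)"
    "\<forall>q\<in>path_image g. free ?P 1 q"
    using lid unfolding reachable_def by blast
  have fr: "free ?P 1 (fst (g t), snd (g t))" if "t \<in> {0..1}" for t
    using g(4) that by (simp add: path_image_def)
  have free: "free ?P 1 (x, y)" using lid by (rule reachable_free)
  then show "x = 0" by (simp add: free_iff)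
  have y: "0 \<le> y" using free by (simp add: free_iff)
  have "y' + b \<le> y" if s: "((x', y'), b) \<in> set ?P" for x' y' b
  proof (rule ccontr)
    assume c: "\<not> y' + b \<le> y"
    have "b \<in> snd ` set ?P" using s by force
    then have "b \<in> set as" using map_snd_run[of bottom_left as] by (metis set_map)
    then have b: "0 < b" using valid by (simp add: valid_input_def)
    have "square ((x', y'), b) \<subseteq> strip" using packing_run[OF valid] s by (simp add: packing_def)
    then have x': "0 \<le> x'" "x' + b \<le> 1" using square_subset_strip_iff[OF b] by auto
    have avoid: "snd (g t) + 1 \<le> y' \<or> y' + b \<le> snd (g t)" if "t \<in> {0..1}" for t
    proof -
      have "b \<le> 0 \<or> fst (g t) + 1 \<le> x' \<or> x' + b \<le> fst (g t) \<or>
          snd (g t) + 1 \<le> y' \<or> y' + b \<le> snd (g t)"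
        using bspec[OF _ s] fr[OF that] unfolding free_iff[OF zero_less_one] by fast
      then show ?thesis using fr[OF that] b x' unfolding free_iff[OF zero_less_one] by auto
    qed
    have "y + 1 \<le> y'" using avoid[of 1] c g(3) by (simp add: pathfinish_def)
    moreover have "y' \<le> snd (g 0)"
      using top_le_height[OF s] b g(2) by (simp add: pathstart_def)
    moreover have "continuous_on {0..1} (\<lambda>t. snd (g t))"
      using g(1) unfolding path_def by (intro continuous_intros)
    \<comment> \<open>At height \<open>y'\<close> the lid overlaps the square, so both alternatives
      of \<open>avoid\<close> fail.\<close>
    ultimately obtain t where "0 \<le> t" "t \<le> 1" "snd (g t) = y'"
      using IVT2'[of "\<lambda>t. snd (g t)" 1 y' 0] g(3) by (auto simp: pathfinish_def)
    then show False using avoid[of t] b by simp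
  qed
  then show "height ?P \<le> y"
    unfolding height_def using y by (intro Max.boundedI) auto
qed

text \<open>The lid adds 1 to the sum of squares, hence the additive \<open>5 / 2\<close>; the other
  squares count \<open>1 + 5 / 2\<close> times, and their area is at most the height of any
  packing.\<close>

theorem height_bottom_left_le:
  assumes valid: "valid_input as"
  shows "height (run bottom_left as) \<le> 7 / 2 * OPT as + 5 / 2"
proof -
  let ?as = "as @ [1]" and ?m = "length as"
  let ?Q = "run bottom_left ?as"
  have valid': "valid_input ?as" using valid by (simp add: valid_input_def)
  have "is_bottom_left (run bottom_left as) 1 (fst (?Q ! ?m))"
    using is_bottom_left_bottom_left[of 1] by (simp add: run_snoc nth_append length_run)
  then have "(fst (fst (?Q ! ?m)), snd (fst (?Q ! ?m))) \<in> reachable (run bottom_left as) 1"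
    by (simp add: is_bottom_left_def)
  note lid = height_le_lid[OF valid this]
  have "snd (fst (?Q ! ?m)) \<le> (\<Sum>k<?m. (?as ! k)\<^sup>2) + 5 / 2 * (\<Sum>k<length ?as. (?as ! k)\<^sup>2)"
    using bottom_left_packing_run[OF valid'] by (rule bottom_left_packing.lid_height_le) (use lid in simp_all)
  moreover have "(\<Sum>k<?m. (?as ! k)\<^sup>2) = (\<Sum>k<?m. (as ! k)\<^sup>2)"
    by (intro sum.cong) (simp_all add: nth_append)
  moreover from this have "(\<Sum>k<length ?as. (?as ! k)\<^sup>2) = (\<Sum>k<?m. (as ! k)\<^sup>2) + 1" by simp
  ultimately have "height (run bottom_left as) \<le> 7 / 2 * (\<Sum>k<?m. (as ! k)\<^sup>2) + 5 / 2"
    using lid(2) by linarith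
  moreover have "(\<Sum>k<?m. (as ! k)\<^sup>2) \<le> OPT as"
    unfolding OPT_def
  proof (rule cInf_greatest)
    show "{height P |P. packing as P} \<noteq> {}" using packing_run[OF valid] by blast
  qed (use sum_squares_le_height valid in blast)
  ultimately show ?thesis by simp
qed

theorem theorem1:
  shows "competitive bottom_left (7 / 2) \<and>
    (\<forall>as. valid_input as \<longrightarrow> height (run bottom_left as) \<le> 7 / 2 * OPT as + 5 / 2)"
  using online_strategy_bottom_left height_bottom_left_le unfolding competitive_def by blast

end
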